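(* Suppose that $\mathcal X$ is compact and that: (i) $\theta^c$ lies in the relative interior of $\Theta$; (ii) $\theta\mapsto\log f(\mathcal S^N|\theta)$ is twice continuously differentiable locally around $\theta^c$; (iii) the Fisher information matrix $\mathcal I(\theta^c)$ is nonsingular; (iv) the prior density $p(\theta)$ is continuous and strictly positive in a neighborhood of $\theta^c$; (v) for all $\theta\in\Theta$, there exists an integrable function $g$ with $|\log f(\xi|\theta)|\le g(\xi)$ and $\mathbb E_{P_{\theta^c}}[g(\xi)]<\infty$, and there exist constants $0<c_1<c_2$ with $c_1\le p(\theta)\le c_2$. Suppose moreover that, for $j\in\{1,\dots,n\}$, $\mathbb E_{Q_j}[\Phi(\cdot,\xi)]$ is continuous on $\mathcal X$ and $\mathbb E_{Q_j}[\varphi(\cdot,\xi)]$ is Lipschitz continuous on $\mathcal X$ with modulus $L_{\varphi,j}>0$. Then $\mathbb D\left(\mathfrak X(\hat\theta_N,\hat r_N),\mathfrak X(\theta^c,r^c)\right)\to0$ almost surely as $N\to\infty$.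
   Context: $\mathcal X\subseteq\mathbb R^d$ is nonempty closed convex with normal cone $\mathcal N_{\mathcal X}(x)=\{v\mid\langle v,y-x\rangle\le0\ \forall y\in\mathcal X\}$. $Q_1,\dots,Q_n$ are fixed probability distributions on $\Xi\subseteq\mathbb R^m$. $\Phi:\mathcal X\times\Xi\to\mathbb R^d$ and $\varphi:\mathcal X\times\Xi\to\mathbb R$ are continuous in $x$ and measurable and $Q_j$-integrable in $\xi$. $\Theta=\{\theta\in\mathbb R^n_+\mid\sum_j\theta_j=1\}$, $\mathbb B(\theta,r)=\{\theta'\mid\|\theta'-\theta\|_\infty\le r\}$. For $\theta\in\Theta$, $r\ge0$, $\mathfrak X(\theta,r)$ is the set of $x\in\mathcal X$ for which there is $\theta'\in\arg\max_{\theta''\in\mathbb B(\theta,r)\cap\Theta}\sum_j\theta''_j\mathbb E_{Q_j}[\varphi(x,\xi)]$ with $0\in\sum_j\theta'_j\mathbb E_{Q_j}[\Phi(x,\xi)]+\mathcal N_{\mathcal X}(x)$. $\mathbb D(S_1,S_2)=\sup_{s_1\in S_1}\inf_{s_2\in S_2}\|s_1-s_2\|_\infty$. Statistical setting: $P_\theta=\sum_j\theta_jQ_j$ has density $f(\cdot|\theta)$, distinct parameters giving distinct distributions; $\theta^c\in\Theta$ is the true parameter; $r^c\ge0$ is fixed; $\xi^1,\xi^2,\dots$ are i.i.d. from $P_{\theta^c}$; $\mathcal S^N=\{\xi^1,\dots,\xi^N\}$; $f(\mathcal S^N|\theta)=\prod_{i=1}^Nf(\xi^i|\theta)$; $p$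 is a prior density on $\Theta$; $\alpha\in(0,1)$. $\hat\theta_N\in\Theta$ is the maximum likelihood estimate, $\mathcal I(\hat\theta_N)=-\frac1N\nabla_\theta^2\log f(\mathcal S^N|\theta)|_{\theta=\hat\theta_N}$, $\Sigma_N=\frac1N\mathcal I(\hat\theta_N)^{-1}$, $\hat\delta_N=\max_j\sqrt{\Sigma_{N,jj}}\,z_{1-\alpha/(2n)}$ ($z_q$ the standard normal $q$-quantile), and $\hat r_N=r^c+\hat\delta_N$. "Almost surely" is with respect to $(P_{\theta^c})^{\mathbb N}$. *)

theory Defs
  imports "HOL-Probability.Probability"
begin

section \<open>The robust variational inequality\<close>

definition normal_cone :: "'a::real_inner set \<Rightarrow> 'a \<Rightarrow> 'a set" where
  "normal_cone X x = {v. \<forall>y\<in>X. v \<bullet> (y - x) \<le> 0}"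

definition prob_simplex :: "(real^'n) set" where
  "prob_simplex = {\<theta>. (\<forall>j. 0 \<le> \<theta> $ j) \<and> (\<Sum>j\<in>UNIV. \<theta> $ j) = 1}"

definition inf_cball :: "'a::euclidean_space \<Rightarrow> real \<Rightarrow> 'a set" where
  "inf_cball \<theta> r = {\<theta>'. infnorm (\<theta>' - \<theta>) \<le> r}"

definition solution_set ::
  "(real^'d) set \<Rightarrow> ('n \<Rightarrow> (real^'m) measure) \<Rightarrow> (real^'d \<Rightarrow> real^'m \<Rightarrow> real^'d) \<Rightarrow>
   (real^'d \<Rightarrow> real^'m \<Rightarrow> real) \<Rightarrow> real^'n \<Rightarrow> real \<Rightarrow> (real^'d) set" where
  "solution_set X Q \<Phi> \<phi> \<theta> r =
    {x\<in>X. \<exists>\<theta>'.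
       is_arg_max (\<lambda>\<theta>''. \<Sum>j\<in>UNIV. \<theta>'' $ j * (\<integral>\<xi>. \<phi> x \<xi> \<partial>Q j))
         (\<lambda>\<theta>''. \<theta>'' \<in> inf_cball \<theta> r \<inter> prob_simplex) \<theta>' \<and>
       0 \<in> (+) (\<Sum>j\<in>UNIV. \<theta>' $ j *\<^sub>R (\<integral>\<xi>. \<Phi> x \<xi> \<partial>Q j)) ` normal_cone X x}"

text \<open>
  The excess takes values in $[0,\infty]$: it is \<open>0\<close> if the first set is empty, and \<open>\<infinity>\<close> if only
  the second one is.
\<close>

definition excess :: "'a::euclidean_space set \<Rightarrow> 'a set \<Rightarrow> ennreal" where
  "excess S1 S2 = (SUP s1\<in>S1. INF s2\<in>S2. ennreal (infnorm (s1 - s2)))"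


section \<open>The mixture model\<close>

definition mixture :: "(real^'m) set \<Rightarrow> ('n \<Rightarrow> (real^'m) measure) \<Rightarrow> real^'n \<Rightarrow> (real^'m) measure" where
  "mixture \<Xi> Q \<theta> = measure_of \<Xi> (sets (restrict_space borel \<Xi>))
     (\<lambda>A. \<Sum>j\<in>UNIV. ennreal (\<theta> $ j) * emeasure (Q j) A)"

text \<open>
  Given densities \<open>q j\<close> of the components \<open>Q j\<close>, the density of the mixture is used for every
  vector \<open>\<theta>\<close>, not only on the simplex. This makes it a function on an open neighbourhood of
  each point of the simplex, so that derivatives in \<open>\<theta>\<close> are ordinary \<open>n\<close>-dimensional ones.
\<close>

definition mixture_density :: "('n \<Rightarrow> real^'m \<Rightarrow> real) \<Rightarrow> real^'n \<Rightarrow> real^'m \<Rightarrow> real" where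
  "mixture_density q \<theta> \<xi> = (\<Sum>j\<in>UNIV. \<theta> $ j * q j \<xi>)"

lemma sets_mixture [measurable_cong]: "sets (mixture \<Xi> Q \<theta>) = sets (restrict_space borel \<Xi>)"
  and space_mixture: "space (mixture \<Xi> Q \<theta>) = \<Xi>"
proof -
  have *: "sigma_algebra \<Xi> (sets (restrict_space borel \<Xi>))"
    using sets.sigma_algebra_axioms[of "restrict_space borel \<Xi>"] by (simp add: space_restrict_space)
  show "sets (mixture \<Xi> Q \<theta>) = sets (restrict_space borel \<Xi>)"
    unfolding mixture_def by (rule sigma_algebra.sets_measure_of_eq[OF *])
  show "space (mixture \<Xi> Q \<theta>) = \<Xi>"
    unfolding mixture_def by (rule sigma_algebra.space_measure_of_eq[OF *])
qed

lemma emeasure_mixture: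
  assumes "\<And>j. sets (Q j) = sets (restrict_space borel \<Xi>)"
    and "A \<in> sets (restrict_space borel \<Xi>)"
  shows "emeasure (mixture \<Xi> Q \<theta>) A = (\<Sum>j\<in>UNIV. ennreal (\<theta> $ j) * emeasure (Q j) A)"
proof (rule emeasure_measure_of[OF mixture_def])
  show "sets (restrict_space borel \<Xi>) \<subseteq> Pow \<Xi>"
    using sets.space_closed[of "restrict_space borel \<Xi>"] by (simp add: space_restrict_space)
  show "A \<in> sets (mixture \<Xi> Q \<theta>)"
    using assms(2) by (simp add: sets_mixture)
  show "positive (sets (mixture \<Xi> Q \<theta>)) (\<lambda>A. \<Sum>j\<in>UNIV. ennreal (\<theta> $ j) * emeasure (Q j) A)"
    by (simp add: positive_def)
  show "countably_additive (sets (mixture \<Xi> Q \<theta>))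
          (\<lambda>A. \<Sum>j\<in>UNIV. ennreal (\<theta> $ j) * emeasure (Q j) A)"
  proof (rule countably_additiveI)
    fix F :: "nat \<Rightarrow> _"
    assume F: "range F \<subseteq> sets (mixture \<Xi> Q \<theta>)" "disjoint_family F"
    then have "range F \<subseteq> sets (Q j)" for j
      by (simp add: assms(1) sets_mixture)
    then have "(\<Sum>i. emeasure (Q j) (F i)) = emeasure (Q j) (\<Union>(range F))" for j
      using F(2) by (rule suminf_emeasure)
    then show "(\<Sum>i. \<Sum>j\<in>UNIV. ennreal (\<theta> $ j) * emeasure (Q j) (F i)) =
          (\<Sum>j\<in>UNIV. ennreal (\<theta> $ j) * emeasure (Q j) (\<Union>(range F)))"
      by (subst suminf_sum) auto
  qed
qed

lemma prob_space_mixture: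
  assumes "\<And>j. sets (Q j) = sets (restrict_space borel \<Xi>)" "\<And>j. prob_space (Q j)"
    and "\<theta> \<in> prob_simplex"
  shows "prob_space (mixture \<Xi> Q \<theta>)"
proof
  have sp: "space (Q j) = \<Xi>" for j
    using sets_eq_imp_space_eq[OF assms(1)] by (simp add: space_restrict_space)
  have "\<Xi> \<in> sets (restrict_space borel \<Xi>)"
    using sets.top[of "restrict_space borel \<Xi>"] by (simp add: space_restrict_space)
  moreover have "emeasure (Q j) \<Xi> = 1" for j
    using prob_space.emeasure_space_1[OF assms(2)] by (simp add: sp)
  ultimately show "emeasure (mixture \<Xi> Q \<theta>) (space (mixture \<Xi> Q \<theta>)) = 1"
    using assms(1,3) by (simp add: space_mixture emeasure_mixture prob_simplex_def sum_ennreal)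
qed

lemma mixture_eq_density:
  assumes "sets \<mu> = sets (restrict_space borel \<Xi>)"
    and "\<And>j. q j \<in> borel_measurable \<mu>" "\<And>j \<xi>. \<xi> \<in> \<Xi> \<Longrightarrow> 0 \<le> q j \<xi>"
    and "\<And>j. Q j = density \<mu> (\<lambda>\<xi>. ennreal (q j \<xi>))"
    and "\<theta> \<in> prob_simplex"
  shows "mixture \<Xi> Q \<theta> = density \<mu> (\<lambda>\<xi>. ennreal (mixture_density q \<theta> \<xi>))"
proof (rule measure_eqI)
  show "sets (mixture \<Xi> Q \<theta>) = sets (density \<mu> (\<lambda>\<xi>. ennreal (mixture_density q \<theta> \<xi>)))"
    by (simp add: sets_mixture assms(1))
  fix A assume "A \<in> sets (mixture \<Xi> Q \<theta>)"
  then have A: "A \<in> sets (restrict_space borel \<Xi>)" "A \<in> sets \<mu>"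
    by (simp_all add: sets_mixture assms(1))
  have sp: "space \<mu> = \<Xi>"
    using sets_eq_imp_space_eq[OF assms(1)] by (simp add: space_restrict_space)
  have pos: "0 \<le> \<theta> $ j" for j
    using assms(5) by (simp add: prob_simplex_def)
  have [measurable]: "mixture_density q \<theta> \<in> borel_measurable \<mu>"
    unfolding mixture_density_def using assms(2) by measurable
  have "emeasure (mixture \<Xi> Q \<theta>) A =
      (\<Sum>j\<in>UNIV. ennreal (\<theta> $ j) * (\<integral>\<^sup>+\<xi>. ennreal (q j \<xi>) * indicator A \<xi> \<partial>\<mu>))"
    using A assms(1,2) by (subst emeasure_mixture) (simp_all add: assms(4) emeasure_density)
  also have "\<dots> = (\<integral>\<^sup>+\<xi>. (\<Sum>j\<in>UNIV. ennreal (\<theta> $ j) * (ennreal (q j \<xi>) * indicator A \<xi>)) \<partial>\<mu>)"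
    using A(2) assms(2) by (subst nn_integral_sum) (auto simp: nn_integral_cmult)
  also have "\<dots> = (\<integral>\<^sup>+\<xi>. ennreal (mixture_density q \<theta> \<xi>) * indicator A \<xi> \<partial>\<mu>)"
  proof (rule nn_integral_cong)
    fix \<xi> assume "\<xi> \<in> space \<mu>"
    then have "ennreal (mixture_density q \<theta> \<xi>) = (\<Sum>j\<in>UNIV. ennreal (\<theta> $ j) * ennreal (q j \<xi>))"
      using pos assms(3) sp by (simp add: mixture_density_def flip: ennreal_mult sum_ennreal)
    then show "(\<Sum>j\<in>UNIV. ennreal (\<theta> $ j) * (ennreal (q j \<xi>) * indicator A \<xi>)) =
        ennreal (mixture_density q \<theta> \<xi>) * indicator A \<xi>"
      by (simp add: sum_distrib_right mult.assoc)
  qed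
  also have "\<dots> = emeasure (density \<mu> (\<lambda>\<xi>. ennreal (mixture_density q \<theta> \<xi>))) A"
    using A(2) by (simp add: emeasure_density)
  finally show "emeasure (mixture \<Xi> Q \<theta>) A =
      emeasure (density \<mu> (\<lambda>\<xi>. ennreal (mixture_density q \<theta> \<xi>))) A" .
qed


section \<open>Gradients and Hessians\<close>

definition gradient :: "(real^'n \<Rightarrow> real) \<Rightarrow> real^'n \<Rightarrow> real^'n" where
  "gradient g x = (\<chi> i. frechet_derivative g (at x) (axis i 1))"

definition hessian :: "(real^'n \<Rightarrow> real) \<Rightarrow> real^'n \<Rightarrow> real^'n^'n" where
  "hessian g x = jacobian (gradient g) (at x)"

definition twice_cont_differentiable_near :: "(real^'n \<Rightarrow> real) \<Rightarrow> real^'n \<Rightarrow> bool" where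
  "twice_cont_differentiable_near g x0 \<longleftrightarrow>
    (\<exists>U. open U \<and> x0 \<in> U \<and>
       (\<forall>x\<in>U. g differentiable at x \<and> gradient g differentiable at x) \<and>
       continuous_on U (hessian g))"


section \<open>Maximum likelihood and the data-driven radius\<close>

text \<open>
  A sequence of observations is a function \<open>\<omega>\<close> on \<open>nat\<close>; the first \<open>N\<close> observations are
  \<open>\<omega> 0, \<dots>, \<omega> (N - 1)\<close>.
\<close>

definition likelihood ::
  "('p \<Rightarrow> 'x \<Rightarrow> real) \<Rightarrow> nat \<Rightarrow> (nat \<Rightarrow> 'x) \<Rightarrow> 'p \<Rightarrow> real" where
  "likelihood f N \<omega> \<theta> = (\<Prod>i<N. f \<theta> (\<omega> i))"

definition is_mle ::
  "(real^'n \<Rightarrow> 'x \<Rightarrow> real) \<Rightarrow> nat \<Rightarrow> (nat \<Rightarrow> 'x) \<Rightarrow> real^'n \<Rightarrow> bool" where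
  "is_mle f N \<omega> = is_arg_max (likelihood f N \<omega>) (\<lambda>\<theta>. \<theta> \<in> prob_simplex)"

definition fisher_information ::
  "(real^'n \<Rightarrow> 'x measure) \<Rightarrow> (real^'n \<Rightarrow> 'x \<Rightarrow> real) \<Rightarrow> real^'n \<Rightarrow> real^'n^'n" where
  "fisher_information P f \<theta> = (\<integral>\<xi>. - hessian (\<lambda>t. ln (f t \<xi>)) \<theta> \<partial>P \<theta>)"

definition observed_information ::
  "(real^'n \<Rightarrow> 'x \<Rightarrow> real) \<Rightarrow> nat \<Rightarrow> (nat \<Rightarrow> 'x) \<Rightarrow> real^'n \<Rightarrow> real^'n^'n" where
  "observed_information f N \<omega> \<theta> =
    - (1 / real N) *\<^sub>R hessian (\<lambda>t. ln (likelihood f N \<omega> t)) \<theta>"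

definition mle_covariance ::
  "(real^'n \<Rightarrow> 'x \<Rightarrow> real) \<Rightarrow> nat \<Rightarrow> (nat \<Rightarrow> 'x) \<Rightarrow> real^'n \<Rightarrow> real^'n^'n" where
  "mle_covariance f N \<omega> \<theta> = (1 / real N) *\<^sub>R matrix_inv (observed_information f N \<omega> \<theta>)"

definition std_normal_quantile :: "real \<Rightarrow> real" where
  "std_normal_quantile q = Inf {x. q \<le> cdf std_normal_distribution x}"

definition mle_radius ::
  "(real^'n \<Rightarrow> 'x \<Rightarrow> real) \<Rightarrow> real \<Rightarrow> nat \<Rightarrow> (nat \<Rightarrow> 'x) \<Rightarrow> real^'n \<Rightarrow> real" where
  "mle_radius f \<alpha> N \<omega> \<theta> =
    (MAX j. sqrt (mle_covariance f N \<omega> \<theta> $ j $ j)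
       * std_normal_quantile (1 - \<alpha> / (2 * real CARD('n))))"

end

theory Submission
  imports Defs
begin

text \<open>
  Writing $q = (q_1, \dots, q_n)$, every statistic needed here is an empirical mean of a function
  of the ratio $u(\xi) = q(\xi) / f(\xi|\theta^c)$. Since $\theta^c$ has positive entries, $u$ takes
  values in a compact set, so that these functions are bounded, and Hoeffding's inequality together
  with the Borel--Cantelli lemma gives a strong law that is uniform over the parameters
  $\theta \ge \theta^c / 2$.

  The midpoint $s_N$ of $\hat\theta_N$ and $\theta^c$ is such a parameter, and by concavity
  of the logarithm the mean of $\ln \langle s_N, u \rangle$ is nonnegative. Its limit is minus a
  Kullback--Leibler divergence, which vanishes only at $\theta^c$ by identifiability; hence
  $\hat\theta_N \to \theta^c$. The entries of the observed information are the means of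
  $u_k u_l / \langle \hat\theta_N, u \rangle^2$; they converge to the Fisher information, which is
  invertible, so $\hat r_N \to r^c$. The conclusion follows because the solution map has a closed
  graph and its values lie in the compact set $\mathcal X$.
\<close>

section \<open>A uniform strong law of large numbers\<close>

lemma indep_vars_PiM_coordinates:
  assumes "prob_space M"
  shows "prob_space.indep_vars (PiM UNIV (\<lambda>_::nat. M)) (\<lambda>_. M) (\<lambda>i \<omega>. \<omega> i) UNIV"
proof -
  interpret P: prob_space "PiM UNIV (\<lambda>_::nat. M)"
    by (intro prob_space_PiM assms)
  have "distr (PiM UNIV (\<lambda>_::nat. M)) M (\<lambda>\<omega>. \<omega> i) = M" for i
    using distr_PiM_component[of UNIV "\<lambda>_::nat. M" i] assms by simp
  then show ?thesis
    by (subst P.indep_vars_iff_distr_eq_PiM') (auto simp: restrict_UNIV distr_id)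
qed

text \<open>By Hoeffding's inequality the probability of a deviation of fixed size decays
  geometrically in \<open>N\<close>. It is therefore summable, and Borel--Cantelli applies.\<close>

lemma strong_law_bounded:
  fixes h :: "'a \<Rightarrow> real"
  assumes M: "prob_space M" and [measurable]: "h \<in> borel_measurable M"
    and bound: "AE x in M. \<bar>h x\<bar> \<le> B"
  shows "AE \<omega> in PiM UNIV (\<lambda>_::nat. M).
    (\<lambda>N. (\<Sum>i<N. h (\<omega> i)) / real N) \<longlonglongrightarrow> (\<integral>x. h x \<partial>M)"
proof -
  let ?P = "PiM UNIV (\<lambda>_::nat. M)"
  let ?m = "\<integral>x. h x \<partial>M"
  let ?avg = "\<lambda>N \<omega>. (\<Sum>i<N. h (\<omega> i)) / real N"
  \<comment> \<open>Positive whatever the sign of \<open>B\<close>, so that the interval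
    \<open>{-b..b}\<close> in Hoeffding's inequality is nondegenerate.\<close>
  define b where "b = \<bar>B\<bar> + 1"
  have b: "0 < b" by (simp add: b_def)
  interpret P: prob_space ?P
    by (intro prob_space_PiM M)
  have distr: "distr ?P M (\<lambda>\<omega>. \<omega> i) = M" for i
    using distr_PiM_component[of UNIV "\<lambda>_::nat. M" i] M by simp
  have distr_h: "distr ?P borel (\<lambda>\<omega>. h (\<omega> i)) = distr M borel h" for i
    by (subst distr[of i, symmetric], subst distr_distr) (auto simp: o_def)
  have mean: "P.expectation (\<lambda>\<omega>. h (\<omega> 0)) = ?m"
    by (subst distr[of 0, symmetric], subst integral_distr) auto
  have tail: "P.prob {\<omega>\<in>space ?P. e \<le> \<bar>?avg N \<omega> - ?m\<bar>} \<le> 2 * exp (- (e\<^sup>2 / (2 * b\<^sup>2))) ^ N"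
    if "0 < e" "0 < N" for e N
  proof -
    interpret H: Hoeffding_ineq_iid ?P "{..<N}" "\<lambda>i \<omega>. h (\<omega> i)" "\<lambda>\<omega>. h (\<omega> 0)" "-b" b ?m
    proof unfold_locales
      have "P.indep_vars (\<lambda>_. borel) (\<lambda>i \<omega>. h (\<omega> i)) UNIV"
        by (rule P.indep_vars_compose2[OF indep_vars_PiM_coordinates[OF M]]) auto
      then show "P.indep_vars (\<lambda>_. borel) (\<lambda>i \<omega>. h (\<omega> i)) {..<N}"
        by (rule P.indep_vars_subset) auto
      have "AE x in M. h x \<in> {-b..b}"
        using bound by eventually_elim (auto simp: b_def)
      then show "AE \<omega> in ?P. h (\<omega> 0) \<in> {-b..b}"
        by (rule AE_PiM_component[of UNIV "\<lambda>_. M" 0, OF M, simplified])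
    qed (auto simp: distr_h mean)
    have "P.prob {\<omega>\<in>space ?P. e \<le> \<bar>?avg N \<omega> - ?m\<bar>} \<le> 2 * exp (-2 * real N * e\<^sup>2 / (b - - b)\<^sup>2)"
      using H.Hoeffding_ineq_abs_ge'[of e] that b by auto
    \<comment> \<open>The interval has length \<open>2 * b\<close>, so the bound is twice the
      \<open>N\<close>-th power of a fixed number below 1.\<close>
    also have "-2 * real N * e\<^sup>2 / (b - - b)\<^sup>2 = real N * (- (e\<^sup>2 / (2 * b\<^sup>2)))"
      using b by (simp add: field_simps power2_eq_square)
    finally show ?thesis by (simp only: exp_of_nat_mult)
  qed
  \<comment> \<open>Countably many tolerances suffice for convergence and allow one null set for all
    of them.\<close>
  have "AE \<omega> in ?P. \<forall>k::nat. eventually (\<lambda>N. \<bar>?avg N \<omega> - ?m\<bar> < inverse (real (Suc k))) sequentially"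
  proof (subst AE_all_countable, rule allI)
    fix k :: nat
    define e where "e = inverse (real (Suc k))"
    have e: "0 < e" by (simp add: e_def)
    define A where "A N = {\<omega>\<in>space ?P. e \<le> \<bar>?avg N \<omega> - ?m\<bar>}" for N
    have [measurable]: "A N \<in> sets ?P" for N unfolding A_def by measurable
    have "exp (- (e\<^sup>2 / (2 * b\<^sup>2))) < 1" using e b by simp
    then have "summable (\<lambda>N. 2 * exp (- (e\<^sup>2 / (2 * b\<^sup>2))) ^ N)"
      by (intro summable_mult summable_geometric) simp
    then have "summable (\<lambda>N. P.prob (A N))"
      by (rule summable_comparison_test_ev[rotated])
        (use tail[OF e] in \<open>auto simp: A_def intro!: eventually_sequentiallyI[of 1]\<close>)
    then have "AE \<omega> in ?P. eventually (\<lambda>N. \<omega> \<in> space ?P - A N) sequentially"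
      by (intro borel_cantelli_AE1) (auto simp: P.emeasure_eq_measure)
    then show "AE \<omega> in ?P. eventually (\<lambda>N. \<bar>?avg N \<omega> - ?m\<bar> < inverse (real (Suc k))) sequentially"
      by eventually_elim (auto elim!: eventually_mono simp: A_def e_def not_le)
  qed
  then show ?thesis
  proof eventually_elim
    case (elim \<omega>)
    show ?case
    proof (rule tendstoI)
      fix e :: real assume "0 < e"
      then obtain k where "inverse (real (Suc k)) < e"
        using reals_Archimedean by blast
      with elim[rule_format, of k] show "\<forall>\<^sub>F N in sequentially. dist (?avg N \<omega>) ?m < e"
        by (auto elim!: eventually_mono simp: dist_real_def)
    qed
  qed
qed

text \<open>Joint uniform continuity on the compact product, applied to pairs with the same second
  coordinate: one \<open>d\<close> serves all \<open>x\<close> in \<open>U\<close>.\<close>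

lemma uniformly_close_on_compact:
  fixes \<psi> :: "'p::metric_space \<Rightarrow> 'x::metric_space \<Rightarrow> real"
  assumes "compact K" "compact U" "continuous_on (K \<times> U) (\<lambda>(t, x). \<psi> t x)" "0 < e"
  obtains d where "0 < d"
    "\<And>s t x. s \<in> K \<Longrightarrow> t \<in> K \<Longrightarrow> x \<in> U \<Longrightarrow> dist s t < d \<Longrightarrow> \<bar>\<psi> s x - \<psi> t x\<bar> < e"
proof -
  have "uniformly_continuous_on (K \<times> U) (\<lambda>(t, x). \<psi> t x)"
    using assms by (intro compact_uniformly_continuous compact_Times)
  then obtain d where d: "0 < d" and
    close: "\<And>z z'. z \<in> K \<times> U \<Longrightarrow> z' \<in> K \<times> U \<Longrightarrow> dist z' z < d \<Longrightarrow>
      dist (case z' of (t, x) \<Rightarrow> \<psi> t x) (case z of (t, x) \<Rightarrow> \<psi> t x) < e"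
    using \<open>0 < e\<close> unfolding uniformly_continuous_on_def by metis
  show thesis
    by (rule that[OF d]) (use close in \<open>force simp: dist_Pair_Pair dist_real_def\<close>)
qed

lemma bounded_on_compact_Times:
  fixes \<psi> :: "'p::metric_space \<Rightarrow> 'x::metric_space \<Rightarrow> real"
  assumes "compact K" "compact U" "continuous_on (K \<times> U) (\<lambda>(t, x). \<psi> t x)"
  obtains B where "\<And>t x. t \<in> K \<Longrightarrow> x \<in> U \<Longrightarrow> \<bar>\<psi> t x\<bar> \<le> B"
proof -
  have "bounded ((\<lambda>(t, x). \<psi> t x) ` (K \<times> U))"
    using assms by (intro compact_imp_bounded compact_continuous_image compact_Times)
  then obtain B where "\<And>z. z \<in> K \<times> U \<Longrightarrow> \<bar>case z of (t, x) \<Rightarrow> \<psi> t x\<bar> \<le> B"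
    unfolding bounded_iff by auto
  then show thesis by (intro that[of B]) force
qed

section \<open>The law of large numbers uniformly over a compact parameter set\<close>

context
  fixes M :: "'a measure" and u :: "'a \<Rightarrow> 'x::metric_space"
    and \<psi> :: "'p::metric_space \<Rightarrow> 'x \<Rightarrow> real" and K U
  assumes M: "prob_space M"
    and K: "compact K" and U: "compact U"
    and cont: "continuous_on (K \<times> U) (\<lambda>(t, x). \<psi> t x)"
    and u: "AE z in M. u z \<in> U"
    and meas: "\<And>t. t \<in> K \<Longrightarrow> (\<lambda>z. \<psi> t (u z)) \<in> borel_measurable M"
begin

lemma integrable_parametric:
  assumes "t \<in> K"
  shows "integrable M (\<lambda>z. \<psi> t (u z))"
proof -
  interpret prob_space M by (rule M)
  obtain B where "\<And>t x. t \<in> K \<Longrightarrow> x \<in> U \<Longrightarrow> \<bar>\<psi> t x\<bar> \<le> B"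
    using bounded_on_compact_Times[OF K U cont] by blast
  with u assms have "AE z in M. norm (\<psi> t (u z)) \<le> B"
    by (auto elim!: eventually_mono)
  then show ?thesis
    by (rule integrable_const_bound) (rule meas[OF assms])
qed

lemma integral_parametric_close:
  assumes "s \<in> K" "t \<in> K" "\<And>x. x \<in> U \<Longrightarrow> \<bar>\<psi> s x - \<psi> t x\<bar> < e"
  shows "\<bar>(\<integral>z. \<psi> s (u z) \<partial>M) - (\<integral>z. \<psi> t (u z) \<partial>M)\<bar> \<le> e"
proof -
  interpret prob_space M by (rule M)
  have int: "integrable M (\<lambda>z. \<psi> s (u z))" "integrable M (\<lambda>z. \<psi> t (u z))"
    using assms integrable_parametric by auto
  have "\<bar>(\<integral>z. \<psi> s (u z) \<partial>M) - (\<integral>z. \<psi> t (u z) \<partial>M)\<bar> = \<bar>\<integral>z. \<psi> s (u z) - \<psi> t (u z) \<partial>M\<bar>"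
    using int by simp
  also have "\<dots> \<le> (\<integral>z. \<bar>\<psi> s (u z) - \<psi> t (u z)\<bar> \<partial>M)"
    by (rule integral_abs_bound)
  also have "\<dots> \<le> (\<integral>z. e \<partial>M)"
    by (rule integral_mono_AE) (use int u assms(3) in \<open>auto elim!: eventually_mono intro: less_imp_le\<close>)
  finally show ?thesis by (simp add: prob_space)
qed

lemma continuous_on_integral_parametric:
  "continuous_on K (\<lambda>t. \<integral>z. \<psi> t (u z) \<partial>M)"
  unfolding continuous_on_iff
proof (intro ballI allI impI)
  fix t and e :: real assume t: "t \<in> K" and e: "0 < e"
  obtain d where d: "0 < d"
    "\<And>s t x. s \<in> K \<Longrightarrow> t \<in> K \<Longrightarrow> x \<in> U \<Longrightarrow> dist s t < d \<Longrightarrow> \<bar>\<psi> s x - \<psi> t x\<bar> < e / 2"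
    using uniformly_close_on_compact[OF K U cont half_gt_zero[OF e]] by blast
  show "\<exists>d>0. \<forall>s\<in>K. dist s t < d \<longrightarrow> dist (\<integral>z. \<psi> s (u z) \<partial>M) (\<integral>z. \<psi> t (u z) \<partial>M) < e"
  proof (intro exI[of _ d] conjI ballI impI d(1))
    fix s assume "s \<in> K" "dist s t < d"
    then have "\<bar>(\<integral>z. \<psi> s (u z) \<partial>M) - (\<integral>z. \<psi> t (u z) \<partial>M)\<bar> \<le> e / 2"
      by (intro integral_parametric_close t d(2)[OF _ t])
    then show "dist (\<integral>z. \<psi> s (u z) \<partial>M) (\<integral>z. \<psi> t (u z) \<partial>M) < e"
      using e by (simp add: dist_real_def)
  qed
qed

text \<open>The pointwise law holds simultaneously on a finite \<open>d\<close>-net of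
  \<open>K\<close>. Uniform closeness of \<open>\<psi> s\<close> and \<open>\<psi> t\<close> for
  nearby parameters carries it to all of \<open>K\<close>, for the averages as well as for the
  integrals.\<close>

lemma uniform_strong_law:
  "AE \<omega> in PiM UNIV (\<lambda>_::nat. M).
     uniform_limit K (\<lambda>N t. (\<Sum>i<N. \<psi> t (u (\<omega> i))) / real N) (\<lambda>t. \<integral>z. \<psi> t (u z) \<partial>M) sequentially"
proof -
  let ?P = "PiM UNIV (\<lambda>_::nat. M)"
  let ?avg = "\<lambda>\<omega> N t. (\<Sum>i<N. \<psi> t (u (\<omega> i))) / real N"
  let ?G = "\<lambda>t. \<integral>z. \<psi> t (u z) \<partial>M"
  obtain B where B: "\<And>t x. t \<in> K \<Longrightarrow> x \<in> U \<Longrightarrow> \<bar>\<psi> t x\<bar> \<le> B"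
    using bounded_on_compact_Times[OF K U cont] by blast
  have law: "AE \<omega> in ?P. (\<lambda>N. ?avg \<omega> N t) \<longlonglongrightarrow> ?G t" if "t \<in> K" for t
    by (rule strong_law_bounded[OF M meas[OF that]])
      (use u B[OF that] in \<open>auto elim!: eventually_mono\<close>)
  have supp: "AE \<omega> in ?P. \<forall>i. u (\<omega> i) \<in> U"
    by (subst AE_all_countable) (use AE_PiM_component[of UNIV "\<lambda>_. M", OF M _ u] in auto)
  have "AE \<omega> in ?P. \<forall>k::nat. eventually (\<lambda>N. \<forall>t\<in>K. \<bar>?avg \<omega> N t - ?G t\<bar> < inverse (real (Suc k))) sequentially"
  proof (subst AE_all_countable, rule allI)
    fix k :: nat
    \<comment> \<open>Three errors occur: average at \<open>s\<close> against average at
      \<open>t\<close>, the same for the integrals, and the law at the net point \<open>s\<close>.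
      Each is at most \<open>e\<close>, so together they stay below \<open>4 * e\<close>.\<close>
    define e where "e = inverse (real (Suc k)) / 4"
    have e: "0 < e" by (simp add: e_def)
    obtain d where d: "0 < d"
      "\<And>s t x. s \<in> K \<Longrightarrow> t \<in> K \<Longrightarrow> x \<in> U \<Longrightarrow> dist s t < d \<Longrightarrow> \<bar>\<psi> s x - \<psi> t x\<bar> < e"
      using uniformly_close_on_compact[OF K U cont e] by blast
    obtain F where F: "finite F" "F \<subseteq> K" "K \<subseteq> (\<Union>x\<in>F. ball x d)"
    proof (rule compactE_image[OF K, of K "\<lambda>x. ball x d"])
      show "K \<subseteq> (\<Union>x\<in>K. ball x d)" using d(1) by auto
    qed auto
    have "AE \<omega> in ?P. \<forall>t\<in>F. (\<lambda>N. ?avg \<omega> N t) \<longlonglongrightarrow> ?G t"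
      by (rule AE_finite_allI[OF F(1)]) (use F(2) in \<open>auto intro!: law\<close>)
    with supp show "AE \<omega> in ?P. eventually (\<lambda>N. \<forall>t\<in>K. \<bar>?avg \<omega> N t - ?G t\<bar> < inverse (real (Suc k))) sequentially"
    proof eventually_elim
      case (elim \<omega>)
      have "eventually (\<lambda>N. \<forall>t\<in>F. dist (?avg \<omega> N t) (?G t) < e) sequentially"
        using elim(2) e F(1) by (auto simp: eventually_ball_finite_distrib dest: tendstoD)
      then show ?case
      proof eventually_elim
        case (elim N)
        show ?case
        proof
          fix t assume t: "t \<in> K"
          then obtain s where s: "s \<in> F" "dist s t < d" using F(3) by auto
          then have sK: "s \<in> K" using F(2) by auto
          have close: "\<bar>\<psi> s x - \<psi> t x\<bar> < e" if "x \<in> U" for x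
            using d(2)[OF sK t that s(2)] .
          have "\<bar>?avg \<omega> N s - ?avg \<omega> N t\<bar> = \<bar>\<Sum>i<N. \<psi> s (u (\<omega> i)) - \<psi> t (u (\<omega> i))\<bar> / real N"
            by (simp add: sum_subtractf flip: diff_divide_distrib)
          also have "\<dots> \<le> (\<Sum>i<N. e) / real N"
            using close \<open>\<forall>i. u (\<omega> i) \<in> U\<close>
            by (intro divide_right_mono order_trans[OF sum_abs] sum_mono) (auto intro: less_imp_le)
          \<comment> \<open>Only an inequality, because for \<open>N = 0\<close> the left side is
            0.\<close>
          also have "\<dots> \<le> e" using e by simp
          finally have "\<bar>?avg \<omega> N s - ?avg \<omega> N t\<bar> \<le> e" .
          moreover have "\<bar>?G s - ?G t\<bar> \<le> e"
            by (rule integral_parametric_close[OF sK t close])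
          moreover have "\<bar>?avg \<omega> N s - ?G s\<bar> < e"
            using elim s(1) by (auto simp: dist_real_def)
          ultimately have "\<bar>?avg \<omega> N t - ?G t\<bar> < 4 * e" by linarith
          then show "\<bar>?avg \<omega> N t - ?G t\<bar> < inverse (real (Suc k))" by (simp add: e_def)
        qed
      qed
    qed
  qed
  then show ?thesis
  proof eventually_elim
    case (elim \<omega>)
    show ?case
    proof (rule uniform_limitI)
      fix e :: real assume "0 < e"
      then obtain k where "inverse (real (Suc k)) < e"
        using reals_Archimedean by blast
      with elim[rule_format, of k]
      show "\<forall>\<^sub>F N in sequentially. \<forall>t\<in>K. dist (?avg \<omega> N t) (?G t) < e"
        by (auto elim!: eventually_mono simp: dist_real_def intro: less_trans)
    qed
  qed
qed

end

text \<open>Triangle inequality through \<open>g (s N)\<close>. This serves averages evaluated at a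
  parameter that itself depends on the sample.\<close>

lemma uniform_limit_compose_tendsto:
  fixes f :: "nat \<Rightarrow> 'p::metric_space \<Rightarrow> 'b::metric_space"
  assumes "uniform_limit K f g sequentially" "continuous_on K g"
    and "\<forall>\<^sub>F N in sequentially. s N \<in> K" "t \<in> K" "s \<longlonglongrightarrow> t"
  shows "(\<lambda>N. f N (s N)) \<longlonglongrightarrow> g t"
proof (rule tendstoI)
  fix e :: real assume e: "0 < e"
  have "(\<lambda>N. g (s N)) \<longlonglongrightarrow> g t"
    using continuous_on_tendsto_compose[OF assms(2,5,4,3)] .
  then have "\<forall>\<^sub>F N in sequentially. dist (g (s N)) (g t) < e / 2"
    using e by (intro tendstoD) auto
  moreover have "\<forall>\<^sub>F N in sequentially. \<forall>x\<in>K. dist (f N x) (g x) < e / 2"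
    using e by (intro uniform_limitD[OF assms(1)]) auto
  ultimately show "\<forall>\<^sub>F N in sequentially. dist (f N (s N)) (g t) < e"
    using assms(3)
  proof eventually_elim
    case (elim N)
    then have "dist (f N (s N)) (g (s N)) < e / 2" by auto
    with elim(1) show ?case by (metis dist_triangle_half_r dist_commute)
  qed
qed

text \<open>Away from \<open>c\<close> the continuous limit \<open>g\<close> has a negative maximum
  by compactness. Uniform convergence makes \<open>f N\<close> negative there as well, which
  excludes the points \<open>s N\<close>.\<close>

lemma approximate_maximizer_tendsto:
  fixes f :: "nat \<Rightarrow> 'p::metric_space \<Rightarrow> real"
  assumes "compact K" and lim: "uniform_limit K f g sequentially" and cont: "continuous_on K g"
    and neg: "\<And>t. t \<in> K \<Longrightarrow> t \<noteq> c \<Longrightarrow> g t < 0"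
    and s: "\<forall>\<^sub>F N in sequentially. s N \<in> K \<and> 0 \<le> f N (s N)"
  shows "s \<longlonglongrightarrow> c"
proof (rule tendstoI)
  fix e :: real assume "0 < e"
  let ?C = "K - ball c e"
  show "\<forall>\<^sub>F N in sequentially. dist (s N) c < e"
  proof (cases "?C = {}")
    case True
    with s show ?thesis by (auto elim!: eventually_mono simp: dist_commute)
  next
    case False
    have "compact ?C" using assms(1) by (intro compact_diff) auto
    moreover have "continuous_on ?C g" by (rule continuous_on_subset[OF cont]) auto
    ultimately obtain m where m: "m \<in> ?C" "\<And>t. t \<in> ?C \<Longrightarrow> g t \<le> g m"
      using continuous_attains_sup[OF _ False] by blast
    have "g m < 0" using m(1) \<open>0 < e\<close> by (intro neg) auto
    then have "\<forall>\<^sub>F N in sequentially. \<forall>t\<in>K. dist (f N t) (g t) < - g m"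
      \<comment> \<open>With tolerance \<open>- g m\<close>, the inequality
        \<open>0 \<le> f N (s N)\<close> forces \<open>g m < g (s N)\<close>, so \<open>s N\<close>
        lies in the ball.\<close>
      by (intro uniform_limitD[OF lim]) auto
    with s show ?thesis
    proof eventually_elim
      case (elim N)
      then have "g m < g (s N)" by (force simp: dist_real_def)
      with m(2) elim(1) show ?case by (force simp: dist_commute not_le)
    qed
  qed
qed

section \<open>Stability of the solution set\<close>

lemma closed_prob_simplex: "closed (prob_simplex :: (real^'n) set)"
proof -
  have "prob_simplex = (\<Inter>j. {\<theta>::real^'n. 0 \<le> \<theta> $ j}) \<inter> {\<theta>. (\<Sum>j\<in>UNIV. \<theta> $ j) = 1}"
    by (auto simp: prob_simplex_def)
  also have "closed \<dots>"
    by (intro closed_Int closed_INT ballI closed_Collect_le closed_Collect_eq continuous_intros)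
  finally show ?thesis .
qed

lemma convex_prob_simplex: "convex (prob_simplex :: (real^'n) set)"
  by (auto simp: convex_def prob_simplex_def sum.distrib simp flip: sum_distrib_left)

lemma compact_prob_simplex: "compact (prob_simplex :: (real^'n) set)"
proof -
  have "bounded (prob_simplex :: (real^'n) set)"
  proof (rule boundedI)
    fix \<theta> :: "real^'n" assume \<theta>: "\<theta> \<in> prob_simplex"
    have "norm \<theta> \<le> (\<Sum>j\<in>UNIV. \<bar>\<theta> $ j\<bar>)" by (rule norm_le_l1_cart)
    then show "norm \<theta> \<le> 1" using \<theta> by (simp add: prob_simplex_def)
  qed
  with closed_prob_simplex show ?thesis by (simp add: compact_eq_bounded_closed)
qed

lemma axis_mem_prob_simplex: "axis j 1 \<in> prob_simplex"
  by (auto simp: prob_simplex_def axis_def)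

text \<open>The segment from the vertex \<open>axis j 1\<close> to a relative interior point can be
  prolonged inside the simplex. If coordinate \<open>j\<close> were 0 at that point, it would become
  negative beyond it.\<close>

lemma rel_interior_prob_simplex_pos:
  assumes "\<theta> \<in> rel_interior (prob_simplex :: (real^'n) set)"
  shows "0 < \<theta> $ j"
proof -
  have "prob_simplex \<noteq> {}" using axis_mem_prob_simplex by blast
  with assms obtain e where e: "1 < e" "(1 - e) *\<^sub>R axis j 1 + e *\<^sub>R \<theta> \<in> prob_simplex"
    using convex_rel_interior_iff[OF convex_prob_simplex] axis_mem_prob_simplex by blast
  then have "0 \<le> (1 - e) + e * \<theta> $ j" by (auto simp: prob_simplex_def dest: spec[of _ j])
  moreover have "0 \<le> \<theta> $ j"
    using assms rel_interior_subset[of prob_simplex] by (auto simp: prob_simplex_def)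
  ultimately show ?thesis using e(1) by (cases "\<theta> $ j = 0") auto
qed

text \<open>The form suited to limits: arg max and normal cone become non-strict inequalities
  between continuous expressions.\<close>

lemma mem_solution_set_iff:
  "x \<in> solution_set X Q \<Phi> \<phi> \<theta> r \<longleftrightarrow> x \<in> X \<and>
    (\<exists>\<theta>'\<in>prob_simplex. infnorm (\<theta>' - \<theta>) \<le> r \<and>
      (\<forall>\<theta>''\<in>prob_simplex. infnorm (\<theta>'' - \<theta>) \<le> r \<longrightarrow>
        (\<Sum>j\<in>UNIV. \<theta>'' $ j * (\<integral>\<xi>. \<phi> x \<xi> \<partial>Q j)) \<le> (\<Sum>j\<in>UNIV. \<theta>' $ j * (\<integral>\<xi>. \<phi> x \<xi> \<partial>Q j))) \<and>
      (\<forall>y\<in>X. 0 \<le> (\<Sum>j\<in>UNIV. \<theta>' $ j *\<^sub>R (\<integral>\<xi>. \<Phi> x \<xi> \<partial>Q j)) \<bullet> (y - x)))"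
proof -
  have zero: "0 \<in> (+) a ` A \<longleftrightarrow> - a \<in> A" for a :: "real^'d" and A
    by (metis (no_types, lifting) ab_left_minus add.commute image_iff neg_eq_iff_add_eq_0)
  show ?thesis
    unfolding solution_set_def is_arg_max_def zero inf_cball_def normal_cone_def
    by (auto simp: not_less)
qed

text \<open>The worst-case weights \<open>\<tau> k\<close> have a convergent subsequence in the
  compact simplex, and each condition passes to the limit. Maximality is the delicate one, since the
  feasible ball moves with \<open>k\<close>.\<close>

lemma solution_set_closed_graph:
  fixes x :: "nat \<Rightarrow> real^'d" and \<theta> :: "nat \<Rightarrow> real^'n"
  assumes cont_\<Phi>: "\<And>j. continuous_on X (\<lambda>x. \<integral>\<xi>. \<Phi> x \<xi> \<partial>Q j)"
    and cont_\<phi>: "\<And>j. continuous_on X (\<lambda>x. \<integral>\<xi>. \<phi> x \<xi> \<partial>Q j)"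
    and sol: "\<And>k. x k \<in> solution_set X Q \<Phi> \<phi> (\<theta> k) (r k)"
    and \<theta>_mem: "\<And>k. \<theta> k \<in> prob_simplex" and x0: "x0 \<in> X"
    and lim: "x \<longlonglongrightarrow> x0" "\<theta> \<longlonglongrightarrow> \<theta>0" "r \<longlonglongrightarrow> r0"
  shows "x0 \<in> solution_set X Q \<Phi> \<phi> \<theta>0 r0"
proof -
  define A where "A z j = (\<integral>\<xi>. \<Phi> z \<xi> \<partial>Q j)" for z j
  define a where "a z j = (\<integral>\<xi>. \<phi> z \<xi> \<partial>Q j)" for z j
  define R where "R k t \<longleftrightarrow> t \<in> prob_simplex \<and> infnorm (t - \<theta> k) \<le> r k \<and>
      (\<forall>\<theta>''\<in>prob_simplex. infnorm (\<theta>'' - \<theta> k) \<le> r k \<longrightarrow>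
        (\<Sum>j\<in>UNIV. \<theta>'' $ j * a (x k) j) \<le> (\<Sum>j\<in>UNIV. t $ j * a (x k) j)) \<and>
      (\<forall>y\<in>X. 0 \<le> (\<Sum>j\<in>UNIV. t $ j *\<^sub>R A (x k) j) \<bullet> (y - x k))" for k t
  have "\<exists>t. R k t" for k
    using sol[of k] unfolding mem_solution_set_iff R_def A_def a_def Bex_def by (rule conjunct2)
  then obtain \<tau> where \<tau>: "\<And>k. R k (\<tau> k)" by metis
  have \<tau>_mem: "\<tau> k \<in> prob_simplex" and \<tau>_ball: "infnorm (\<tau> k - \<theta> k) \<le> r k" for k
    using \<tau>[of k] by (simp_all add: R_def)
  have \<tau>_max: "(\<Sum>j\<in>UNIV. \<theta>'' $ j * a (x k) j) \<le> (\<Sum>j\<in>UNIV. \<tau> k $ j * a (x k) j)"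
    if "\<theta>'' \<in> prob_simplex" "infnorm (\<theta>'' - \<theta> k) \<le> r k" for k \<theta>''
    using \<tau>[of k] that by (simp add: R_def)
  have \<tau>_VI: "0 \<le> (\<Sum>j\<in>UNIV. \<tau> k $ j *\<^sub>R A (x k) j) \<bullet> (y - x k)" if "y \<in> X" for k y
    using \<tau>[of k] that by (simp add: R_def)
  obtain \<tau>0 s where \<tau>0: "\<tau>0 \<in> prob_simplex" "strict_mono s" "(\<tau> \<circ> s) \<longlonglongrightarrow> \<tau>0"
    using seq_compactE[OF compact_imp_seq_compact[OF compact_prob_simplex], of \<tau>] \<tau>_mem by metis
  have lx: "(\<lambda>k. x (s k)) \<longlonglongrightarrow> x0" and l\<theta>: "(\<lambda>k. \<theta> (s k)) \<longlonglongrightarrow> \<theta>0"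
    and lr: "(\<lambda>k. r (s k)) \<longlonglongrightarrow> r0" and l\<tau>: "(\<lambda>k. \<tau> (s k)) \<longlonglongrightarrow> \<tau>0"
    using \<tau>0(3) lim[THEN LIMSEQ_subseq_LIMSEQ, OF \<tau>0(2)] by (simp_all add: o_def)
  have x_mem: "\<forall>\<^sub>F k in sequentially. x (s k) \<in> X"
    using sol by (auto simp: mem_solution_set_iff)
  have lA: "(\<lambda>k. A (x (s k)) j) \<longlonglongrightarrow> A x0 j" for j
    unfolding A_def by (rule continuous_on_tendsto_compose[OF cont_\<Phi> lx x0 x_mem])
  have la: "(\<lambda>k. a (x (s k)) j) \<longlonglongrightarrow> a x0 j" for j
    unfolding a_def by (rule continuous_on_tendsto_compose[OF cont_\<phi> lx x0 x_mem])
  have \<theta>0: "\<theta>0 \<in> prob_simplex"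
    using closed_sequentially[OF closed_prob_simplex _ l\<theta>] \<theta>_mem by blast
  have ball0: "infnorm (\<tau>0 - \<theta>0) \<le> r0"
    by (rule LIMSEQ_le[OF tendsto_infnorm[OF tendsto_diff[OF l\<tau> l\<theta>]] lr]) (use \<tau>_ball in auto)
  \<comment> \<open>A competitor \<open>y\<close> need not be feasible for \<open>\<theta> (s k)\<close>; pulling it towards the centre makes it so,
    except for \<open>r0 = 0\<close>, where the centre is the only competitor.\<close>
  have shrink: "(\<Sum>j\<in>UNIV. ((1 - l) *\<^sub>R y + l *\<^sub>R \<theta>0) $ j * a x0 j) \<le> (\<Sum>j\<in>UNIV. \<tau>0 $ j * a x0 j)"
    if y: "y \<in> prob_simplex" "infnorm (y - \<theta>0) \<le> r0" and l: "0 < l" "l \<le> 1" "0 < r0 \<or> l = 1" for y l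
  proof -
    define z where "z k = (1 - l) *\<^sub>R y + l *\<^sub>R \<theta> (s k)" for k
    have z: "z k \<in> prob_simplex" for k
      unfolding z_def using y \<theta>_mem l by (intro convexD[OF convex_prob_simplex]) auto
    have zdiff: "infnorm (z k - \<theta> (s k)) = (1 - l) * infnorm (y - \<theta> (s k))" for k
    proof -
      have "z k - \<theta> (s k) = (1 - l) *\<^sub>R (y - \<theta> (s k))"
        by (simp add: z_def algebra_simps)
      then show ?thesis using l by (simp add: infnorm_mul)
    qed
    have "\<forall>\<^sub>F k in sequentially. infnorm (z k - \<theta> (s k)) \<le> r (s k)"
    proof (cases "l = 1")
      case True
      \<comment> \<open>The ball contains \<open>\<tau> k\<close>, so its radius is nonnegative and
        its centre is feasible.\<close>
      have "0 \<le> r k" for k using \<tau>_ball[of k] infnorm_pos_le[of "\<tau> k - \<theta> k"] by linarith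
      with True show ?thesis by (simp add: zdiff)
    next
      case False
      with l have r0: "0 < r0" and l1: "l < 1" by auto
      have "(\<lambda>k. r (s k) - (1 - l) * infnorm (y - \<theta> (s k))) \<longlonglongrightarrow> r0 - (1 - l) * infnorm (y - \<theta>0)"
        by (intro tendsto_intros tendsto_infnorm lr l\<theta>)
      moreover have "(1 - l) * infnorm (y - \<theta>0) \<le> (1 - l) * r0"
        using y(2) l by (intro mult_left_mono) auto
      \<comment> \<open>The limiting slack is at least \<open>l * r0\<close>; being strictly
        positive, it makes \<open>z k\<close> feasible for all large \<open>k\<close>.\<close>
      then have "0 < r0 - (1 - l) * infnorm (y - \<theta>0)"
        using mult_pos_pos[OF l(1) r0] by (simp add: algebra_simps)
      ultimately have "\<forall>\<^sub>F k in sequentially. 0 < r (s k) - (1 - l) * infnorm (y - \<theta> (s k))"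
        by (rule order_tendstoD)
      then show ?thesis by (auto elim!: eventually_mono simp: zdiff)
    qed
    then have ev: "\<forall>\<^sub>F k in sequentially.
        (\<Sum>j\<in>UNIV. z k $ j * a (x (s k)) j) \<le> (\<Sum>j\<in>UNIV. \<tau> (s k) $ j * a (x (s k)) j)"
      by eventually_elim (rule \<tau>_max[OF z])
    show ?thesis
      by (rule tendsto_le[OF _ _ _ ev])
        (auto simp: z_def intro!: tendsto_intros la l\<tau> l\<theta>)
  qed
  have max0: "(\<Sum>j\<in>UNIV. y $ j * a x0 j) \<le> (\<Sum>j\<in>UNIV. \<tau>0 $ j * a x0 j)"
    if y: "y \<in> prob_simplex" "infnorm (y - \<theta>0) \<le> r0" for y
  proof (cases "0 < r0")
    case True
    \<comment> \<open>Letting the contraction factor \<open>l\<close> tend to 0 recovers the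
      competitor \<open>y\<close> itself.\<close>
    have "((\<lambda>l. \<Sum>j\<in>UNIV. ((1 - l) *\<^sub>R y + l *\<^sub>R \<theta>0) $ j * a x0 j) \<longlongrightarrow>
        (\<Sum>j\<in>UNIV. ((1 - 0) *\<^sub>R y + 0 *\<^sub>R \<theta>0) $ j * a x0 j)) (at_right (0::real))"
      by (intro tendsto_intros)
    moreover have "\<forall>\<^sub>F l in at_right (0::real).
        (\<Sum>j\<in>UNIV. ((1 - l) *\<^sub>R y + l *\<^sub>R \<theta>0) $ j * a x0 j) \<le> (\<Sum>j\<in>UNIV. \<tau>0 $ j * a x0 j)"
      unfolding eventually_at_right_field using shrink[OF y] True by (intro exI[of _ 1]) auto
    ultimately have "(\<Sum>j\<in>UNIV. ((1 - 0) *\<^sub>R y + 0 *\<^sub>R \<theta>0) $ j * a x0 j) \<le> (\<Sum>j\<in>UNIV. \<tau>0 $ j * a x0 j)"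
      by (intro tendsto_upperbound) auto
    then show ?thesis by simp
  next
    case False
    with y(2) infnorm_pos_le[of "y - \<theta>0"] have "infnorm (y - \<theta>0) = 0" by linarith
    then have "y = \<theta>0" by (simp add: infnorm_eq_0)
    with shrink[OF y, of 1] show ?thesis by simp
  qed
  have VI0: "0 \<le> (\<Sum>j\<in>UNIV. \<tau>0 $ j *\<^sub>R A x0 j) \<bullet> (y - x0)" if "y \<in> X" for y
  proof (rule tendsto_lowerbound)
    show "(\<lambda>k. (\<Sum>j\<in>UNIV. \<tau> (s k) $ j *\<^sub>R A (x (s k)) j) \<bullet> (y - x (s k))) \<longlonglongrightarrow>
        (\<Sum>j\<in>UNIV. \<tau>0 $ j *\<^sub>R A x0 j) \<bullet> (y - x0)"
      by (intro tendsto_intros lA l\<tau> lx)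
  qed (use \<tau>_VI[OF that] in auto)
  show ?thesis
    unfolding mem_solution_set_iff using x0 \<tau>0(1) ball0 max0 VI0 by (auto simp: A_def a_def)
qed

section \<open>Convergence of the excess\<close>

lemma excess_le:
  assumes "\<And>x. x \<in> A \<Longrightarrow> \<exists>y\<in>B. infnorm (x - y) \<le> e"
  shows "excess A B \<le> ennreal e"
  unfolding excess_def
proof (rule SUP_least)
  fix x assume "x \<in> A"
  with assms obtain y where "y \<in> B" "infnorm (x - y) \<le> e" by blast
  then show "(INF y\<in>B. ennreal (infnorm (x - y))) \<le> ennreal e"
    by (intro INF_lower2[of y] ennreal_leI)
qed

text \<open>Otherwise infinitely many solution sets contain a point farther than some
  \<open>e\<close> from the limit set. A subsequence of these points converges in \<open>X\<close>,
  and the closed graph puts its limit into the limit set. If the limit set is empty, the same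
  argument shows that the solution sets are eventually empty.\<close>

lemma excess_solution_set_tendsto_0:
  fixes \<theta> :: "nat \<Rightarrow> real^'n" and X :: "(real^'d) set"
  assumes X: "compact X"
    and cont_\<Phi>: "\<And>j. continuous_on X (\<lambda>x. \<integral>\<xi>. \<Phi> x \<xi> \<partial>Q j)"
    and cont_\<phi>: "\<And>j. continuous_on X (\<lambda>x. \<integral>\<xi>. \<phi> x \<xi> \<partial>Q j)"
    and \<theta>_mem: "\<forall>\<^sub>F k in sequentially. \<theta> k \<in> prob_simplex"
    and lim: "\<theta> \<longlonglongrightarrow> \<theta>0" "r \<longlonglongrightarrow> r0"
  shows "(\<lambda>N. excess (solution_set X Q \<Phi> \<phi> (\<theta> N) (r N)) (solution_set X Q \<Phi> \<phi> \<theta>0 r0)) \<longlonglongrightarrow> 0"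
proof -
  let ?S = "\<lambda>N. solution_set X Q \<Phi> \<phi> (\<theta> N) (r N)"
  let ?T = "solution_set X Q \<Phi> \<phi> \<theta>0 r0"
  have close: "\<forall>\<^sub>F N in sequentially. \<forall>x\<in>?S N. \<exists>y\<in>?T. infnorm (x - y) \<le> e" if e: "0 < e" for e
  proof (rule ccontr)
    assume "\<not> ?thesis"
    then have "\<exists>\<^sub>F N in sequentially. \<exists>x\<in>?S N. \<forall>y\<in>?T. e < infnorm (x - y)"
      by (simp add: not_eventually not_le)
    \<comment> \<open>Simplex membership, which holds only eventually, is built into the bad indices
      so that it holds along the whole extracted subsequence.\<close>
    then have "\<exists>\<^sub>F N in sequentially. (\<exists>x\<in>?S N. \<forall>y\<in>?T. e < infnorm (x - y)) \<and> \<theta> N \<in> prob_simplex"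
      by (rule frequently_rev_mp) (use \<theta>_mem in \<open>auto elim!: eventually_mono\<close>)
    moreover define bad where
      "bad = {N. (\<exists>x\<in>?S N. \<forall>y\<in>?T. e < infnorm (x - y)) \<and> \<theta> N \<in> prob_simplex}"
    ultimately have "infinite bad"
      by (simp add: frequently_cofinite flip: cofinite_eq_sequentially)
    then obtain s :: "nat \<Rightarrow> nat" where s: "strict_mono s" and "\<And>k. s k \<in> bad"
      using infinite_enumerate by blast
    then have far: "\<exists>x\<in>?S (s k). \<forall>y\<in>?T. e < infnorm (x - y)" and mem: "\<theta> (s k) \<in> prob_simplex" for k
      unfolding bad_def by simp_all
    from far obtain x where x: "\<And>k. x k \<in> ?S (s k)" and x_far: "\<And>k y. y \<in> ?T \<Longrightarrow> e < infnorm (x k - y)"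
      by metis
    have "x k \<in> X" for k using x[of k] by (simp add: mem_solution_set_iff)
    then obtain x0 t where t: "x0 \<in> X" "strict_mono t" "(x \<circ> t) \<longlonglongrightarrow> x0"
      using seq_compactE[OF compact_imp_seq_compact[OF X], of x] by metis
    have "x0 \<in> ?T"
    proof (rule solution_set_closed_graph[OF cont_\<Phi> cont_\<phi> _ _ t(1,3)])
      show "(x \<circ> t) k \<in> solution_set X Q \<Phi> \<phi> ((\<theta> \<circ> (s \<circ> t)) k) ((r \<circ> (s \<circ> t)) k)" for k
        using x by simp
      show "(\<theta> \<circ> (s \<circ> t)) k \<in> prob_simplex" for k using mem by simp
      show "(\<theta> \<circ> (s \<circ> t)) \<longlonglongrightarrow> \<theta>0" "(r \<circ> (s \<circ> t)) \<longlonglongrightarrow> r0"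
        using lim s t(2) by (auto intro!: LIMSEQ_subseq_LIMSEQ strict_mono_o)
    qed
    have "(\<lambda>k. infnorm ((x \<circ> t) k - x0)) \<longlonglongrightarrow> infnorm (x0 - x0)"
      by (intro tendsto_infnorm tendsto_intros t(3))
    then have "(\<lambda>k. infnorm (x (t k) - x0)) \<longlonglongrightarrow> 0" by (simp add: infnorm_0)
    then have "\<forall>\<^sub>F k in sequentially. infnorm (x (t k) - x0) < e"
      using e by (rule order_tendstoD)
    then obtain k where "infnorm (x (t k) - x0) < e"
      by (auto simp: eventually_sequentially)
    with x_far[OF \<open>x0 \<in> ?T\<close>, of "t k"] show False by simp
  qed
  show ?thesis
  proof (rule order_tendstoI)
    \<comment> \<open>As \<open>a\<close> may be infinite, a finite \<open>b\<close> strictly below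
      it provides the real tolerance.\<close>
    fix a :: ennreal assume "0 < a"
    then obtain b where b: "0 < b" "b < a" using dense by blast
    then have "b < \<infinity>" by (auto simp: less_top[symmetric])
    then obtain e where e: "b = ennreal e" "0 < e" using b(1) by (cases b) (auto simp: ennreal_less_zero_iff)
    show "\<forall>\<^sub>F N in sequentially. excess (?S N) ?T < a"
      using close[OF e(2)]
    proof eventually_elim
      case (elim N)
      then have "excess (?S N) ?T \<le> b" unfolding e(1) by (intro excess_le) auto
      with b(2) show ?case by simp
    qed
  qed simp
qed

section \<open>Derivatives of the log-likelihood and inverse matrices\<close>

context
  fixes a :: "nat \<Rightarrow> real^'n" and N :: nat
begin

lemma open_pos_inner: "open {t. \<forall>i<N. 0 < t \<bullet> a i}"
proof -
  have "{t. \<forall>i<N. 0 < t \<bullet> a i} = (\<Inter>i\<in>{..<N}. {t. 0 < t \<bullet> a i})" by auto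
  also have "open \<dots>"
    by (intro open_INT ballI open_Collect_less continuous_intros) auto
  finally show ?thesis .
qed

text \<open>The logarithm of the product splits into a sum only where all factors are positive. That
  set is open, so the derivative of the sum transfers.\<close>

lemma gradient_ln_prod_inner:
  assumes "\<And>i. i < N \<Longrightarrow> 0 < t \<bullet> a i"
  shows "gradient (\<lambda>t. ln (\<Prod>i<N. t \<bullet> a i)) t = (\<Sum>i<N. (1 / (t \<bullet> a i)) *\<^sub>R a i)"
proof -
  have "((\<lambda>t. \<Sum>i<N. ln (t \<bullet> a i)) has_derivative (\<lambda>h. \<Sum>i<N. (h \<bullet> a i) / (t \<bullet> a i))) (at t)"
    using assms by (auto intro!: derivative_eq_intros sum.cong simp: divide_inverse)
  then have "((\<lambda>t. ln (\<Prod>i<N. t \<bullet> a i)) has_derivative (\<lambda>h. \<Sum>i<N. (h \<bullet> a i) / (t \<bullet> a i))) (at t)"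
    by (rule has_derivative_transform_within_open[OF _ open_pos_inner])
      (use assms in \<open>auto intro!: ln_prod[symmetric]\<close>)
  then have "frechet_derivative (\<lambda>t. ln (\<Prod>i<N. t \<bullet> a i)) (at t) = (\<lambda>h. \<Sum>i<N. (h \<bullet> a i) / (t \<bullet> a i))"
    by (rule frechet_derivative_at[symmetric])
  then show ?thesis
    by (simp add: gradient_def vec_eq_iff inner_axis')
qed

text \<open>The gradient formula holds on a whole neighbourhood of \<open>t\<close> and can be
  differentiated once more.\<close>

lemma hessian_ln_prod_inner:
  assumes "\<And>i. i < N \<Longrightarrow> 0 < t \<bullet> a i"
  shows "hessian (\<lambda>t. ln (\<Prod>i<N. t \<bullet> a i)) t $ k $ l = - (\<Sum>i<N. a i $ k * a i $ l / (t \<bullet> a i)\<^sup>2)"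
proof -
  let ?D = "\<lambda>h. \<Sum>i<N. (- (h \<bullet> a i) / (t \<bullet> a i)\<^sup>2) *\<^sub>R a i"
  have "((\<lambda>t. \<Sum>i<N. (1 / (t \<bullet> a i)) *\<^sub>R a i) has_derivative ?D) (at t)"
    using assms
    by (force intro!: derivative_eq_intros sum.cong simp: power2_eq_square divide_inverse less_imp_neq)
  then have "(gradient (\<lambda>t. ln (\<Prod>i<N. t \<bullet> a i)) has_derivative ?D) (at t)"
    by (rule has_derivative_transform_within_open[OF _ open_pos_inner])
      (use assms in \<open>auto simp: gradient_ln_prod_inner\<close>)
  then have "frechet_derivative (gradient (\<lambda>t. ln (\<Prod>i<N. t \<bullet> a i))) (at t) = ?D"
    by (rule frechet_derivative_at[symmetric])
  then show ?thesis
    by (simp add: hessian_def jacobian_def matrix_def inner_axis' sum_negf mult.commute)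
qed

end

section \<open>Continuity of matrix inversion and the radius\<close>

lemma matrix_inv_right_inverse:
  fixes A :: "'a::semiring_1^'n^'m"
  assumes "invertible A"
  shows "A ** matrix_inv A = mat 1"
  using assms someI_ex[of "\<lambda>A'. A ** A' = mat 1 \<and> A' ** A = mat 1"]
  unfolding invertible_def matrix_inv_def by blast

text \<open>Column \<open>l\<close> of the inverse solves \<open>A *v x = axis l 1\<close>, to which
  Cramer's rule applies. The entries are thus quotients of polynomials in the entries of
  \<open>A\<close>, which gives continuity.\<close>

lemma matrix_inv_cramer:
  fixes A :: "real^'n^'n"
  assumes "det A \<noteq> 0"
  shows "matrix_inv A $ k $ l = det (\<chi> i j. if j = k then axis l 1 $ i else A $ i $ j) / det A"
proof -
  have "A *v (matrix_inv A *v axis l 1) = axis l 1"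
    using assms by (simp add: matrix_vector_mul_assoc matrix_inv_right_inverse invertible_det_nz)
  then have "(matrix_inv A *v axis l 1) $ k = det (\<chi> i j. if j = k then axis l 1 $ i else A $ i $ j) / det A"
    unfolding cramer[OF assms] by simp
  then show ?thesis by (simp add: matrix_vector_mult_basis column_def)
qed

lemma tendsto_det:
  fixes A :: "'b \<Rightarrow> real^'n^'n"
  assumes "\<And>i j. ((\<lambda>x. A x $ i $ j) \<longlongrightarrow> B $ i $ j) F"
  shows "((\<lambda>x. det (A x)) \<longlongrightarrow> det B) F"
  unfolding det_def by (intro tendsto_intros assms)

lemma tendsto_matrix_inv:
  fixes A :: "nat \<Rightarrow> real^'n^'n"
  assumes "invertible B" and lim: "\<And>i j. (\<lambda>N. A N $ i $ j) \<longlonglongrightarrow> B $ i $ j"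
  shows "(\<lambda>N. matrix_inv (A N) $ k $ l) \<longlonglongrightarrow> matrix_inv B $ k $ l"
proof -
  have B: "det B \<noteq> 0" using assms(1) by (simp add: invertible_det_nz)
  have ldet: "(\<lambda>N. det (A N)) \<longlonglongrightarrow> det B" by (rule tendsto_det[OF lim])
  have "(\<lambda>N. det (\<chi> i j. if j = k then axis l 1 $ i else A N $ i $ j) / det (A N)) \<longlonglongrightarrow>
      det (\<chi> i j. if j = k then axis l 1 $ i else B $ i $ j) / det B"
    by (intro tendsto_divide ldet B tendsto_det) (simp add: lim)
  also have "det (\<chi> i j. if j = k then axis l 1 $ i else B $ i $ j) / det B = matrix_inv B $ k $ l"
    by (rule matrix_inv_cramer[OF B, symmetric])
  \<comment> \<open>Cramer's formula describes the inverse of \<open>A N\<close> once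
    \<open>det (A N)\<close> is nonzero, hence for all large \<open>N\<close>.\<close>
  finally show ?thesis
    by (rule Lim_transform_eventually)
      (use tendsto_imp_eventually_ne[OF ldet B] in \<open>auto elim!: eventually_mono simp: matrix_inv_cramer\<close>)
qed

lemma tendsto_Max_0:
  fixes f :: "'i::finite \<Rightarrow> nat \<Rightarrow> real"
  assumes "\<And>j. f j \<longlonglongrightarrow> 0"
  shows "(\<lambda>N. MAX j. f j N) \<longlonglongrightarrow> 0"
proof (rule Lim_null_comparison)
  show "\<forall>\<^sub>F N in sequentially. norm (MAX j. f j N) \<le> (\<Sum>j\<in>UNIV. \<bar>f j N\<bar>)"
  proof (rule always_eventually, rule allI)
    fix N
    have "(MAX j. f j N) \<in> range (\<lambda>j. f j N)" by (rule Max_in) auto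
    then obtain j where "(MAX j. f j N) = f j N" by (rule rangeE)
    moreover have "\<bar>f j N\<bar> \<le> (\<Sum>j\<in>UNIV. \<bar>f j N\<bar>)" by (rule member_le_sum) auto
    ultimately show "norm (MAX j. f j N) \<le> (\<Sum>j\<in>UNIV. \<bar>f j N\<bar>)" by simp
  qed
  have "(\<lambda>N. \<Sum>j\<in>UNIV. \<bar>f j N\<bar>) \<longlonglongrightarrow> (\<Sum>j\<in>(UNIV::'i set). \<bar>0\<bar>)"
    by (intro tendsto_intros assms)
  then show "(\<lambda>N. \<Sum>j\<in>UNIV. \<bar>f j N\<bar>) \<longlonglongrightarrow> 0" by simp
qed

text \<open>The inverse information converges entrywise because its limit exists, so the factor
  \<open>1 / real N\<close> drives the variances to 0; the quantile is constant in
  \<open>N\<close>.\<close>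

lemma mle_radius_tendsto_0:
  fixes \<theta> :: "nat \<Rightarrow> real^'n"
  assumes "invertible B"
    and "\<And>i j. (\<lambda>N. observed_information f N \<omega> (\<theta> N) $ i $ j) \<longlonglongrightarrow> B $ i $ j"
  shows "(\<lambda>N. mle_radius f \<alpha> N \<omega> (\<theta> N)) \<longlonglongrightarrow> 0"
  unfolding mle_radius_def
proof (rule tendsto_Max_0)
  fix j :: 'n
  have "(\<lambda>N. 1 / real N * matrix_inv (observed_information f N \<omega> (\<theta> N)) $ j $ j) \<longlonglongrightarrow> 0 * matrix_inv B $ j $ j"
    by (intro tendsto_mult tendsto_matrix_inv assms lim_1_over_n)
  then have "(\<lambda>N. sqrt (mle_covariance f N \<omega> (\<theta> N) $ j $ j)) \<longlonglongrightarrow> sqrt 0"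
    unfolding mle_covariance_def by (intro tendsto_real_sqrt) simp
  then show "(\<lambda>N. sqrt (mle_covariance f N \<omega> (\<theta> N) $ j $ j)
      * std_normal_quantile (1 - \<alpha> / (2 * real CARD('n)))) \<longlonglongrightarrow> 0"
    by (intro tendsto_mult_left_zero) simp
qed

text \<open>Expansion in matrix units, by which a matrix-valued integral reduces to scalar
  integrals.\<close>

lemma matrix_unit_expansion_nth:
  fixes a :: "'m::finite \<Rightarrow> 'n::finite \<Rightarrow> real"
  shows "(\<Sum>k\<in>UNIV. \<Sum>l\<in>UNIV. a k l *\<^sub>R axis k (axis l 1)) $ i $ j = a i j"
proof -
  have "(\<Sum>k\<in>UNIV. \<Sum>l\<in>UNIV. a k l *\<^sub>R axis k (axis l 1)) $ i $ j =
      (\<Sum>k\<in>UNIV. \<Sum>l\<in>UNIV. if k = i then if l = j then a k l else 0 else 0)"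
    by (auto simp: axis_def intro!: sum.cong)
  also have "\<dots> = (\<Sum>k\<in>UNIV. if k = i then \<Sum>l\<in>UNIV. if l = j then a k l else 0 else 0)"
    by (intro sum.cong) auto
  also have "\<dots> = a i j" by simp
  finally show ?thesis .
qed


section \<open>Consistency of the maximum likelihood estimate\<close>

context
  fixes \<Xi> :: "(real^'m) set" and Q :: "'n::finite \<Rightarrow> (real^'m) measure"
    and \<mu> :: "(real^'m) measure" and q :: "'n \<Rightarrow> real^'m \<Rightarrow> real" and c :: "real^'n"
  assumes Q: "\<And>j. prob_space (Q j)" "\<And>j. sets (Q j) = sets (restrict_space borel \<Xi>)"
    and \<mu>: "sets \<mu> = sets (restrict_space borel \<Xi>)"
    and q: "\<And>j. q j \<in> borel_measurable \<mu>" "\<And>j \<xi>. \<xi> \<in> \<Xi> \<Longrightarrow> 0 \<le> q j \<xi>"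
      "\<And>j. Q j = density \<mu> (\<lambda>\<xi>. ennreal (q j \<xi>))"
    and c: "c \<in> prob_simplex" "\<And>j. 0 < c $ j"
begin

section \<open>Density ratios and their compact range\<close>

private abbreviation (input) "P \<equiv> mixture \<Xi> Q c"
private abbreviation (input) "f \<equiv> mixture_density q"

text \<open>The vector \<open>u\<close> of the overview. Unlike the densities themselves it is
  bounded. Where the true density is 0, division by zero makes it the zero vector.\<close>

definition density_ratio :: "real^'m \<Rightarrow> real^'n" where
  "density_ratio \<xi> = (\<chi> j. q j \<xi> / f c \<xi>)"

text \<open>The factor 1/2 makes room for the midpoint of \<open>c\<close> and any point of the
  simplex, while keeping \<open>t \<bullet> x\<close> away from 0 for \<open>x\<close> in
  \<open>ratio_range\<close>.\<close>

definition core_simplex :: "(real^'n) set" where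
  "core_simplex = {t \<in> prob_simplex. \<forall>j. c $ j / 2 \<le> t $ j}"

text \<open>The condition \<open>c \<bullet> x = 1\<close> expresses that the true density divided
  by itself is 1.\<close>

definition ratio_range :: "(real^'n) set" where
  "ratio_range = {x. (\<forall>j. 0 \<le> x $ j) \<and> c \<bullet> x = 1}"

lemma prob_space_true: "prob_space P"
  by (rule prob_space_mixture[OF Q(2,1) c(1)])

lemma sets_true: "sets P = sets \<mu>"
  by (simp add: sets_mixture \<mu>)

lemma space_reference: "space \<mu> = \<Xi>"
  using sets_eq_imp_space_eq[OF \<mu>] by (simp add: space_restrict_space)

lemma mixture_density_eq_inner: "f t \<xi> = t \<bullet> (\<chi> j. q j \<xi>)"
  by (simp add: mixture_density_def inner_vec_def)

lemma inner_ratio: "t \<bullet> density_ratio \<xi> = f t \<xi> / f c \<xi>"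
  by (simp add: density_ratio_def inner_vec_def mixture_density_def sum_divide_distrib)

lemma mixture_density_nonneg:
  "t \<in> prob_simplex \<Longrightarrow> \<xi> \<in> \<Xi> \<Longrightarrow> 0 \<le> f t \<xi>"
  using q(2) by (auto simp: mixture_density_def prob_simplex_def intro!: sum_nonneg)

text \<open>All weights \<open>c $ j\<close> are positive, so a vanishing sum of nonnegative terms
  forces every component density to vanish.\<close>

lemma components_zero:
  assumes "\<xi> \<in> \<Xi>" "f c \<xi> = 0"
  shows "q j \<xi> = 0"
proof -
  have "\<forall>j\<in>UNIV. c $ j * q j \<xi> = 0"
    using assms q(2) unfolding mixture_density_def
    by (subst (asm) sum_nonneg_eq_0_iff) (auto intro!: mult_nonneg_nonneg less_imp_le[OF c(2)])
  then have "c $ j * q j \<xi> = 0" by blast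
  then show ?thesis using c(2)[of j] by simp
qed

lemma measurable_component_density [measurable]: "q j \<in> borel_measurable P"
  using q(1) by (simp add: measurable_cong_sets[OF sets_true refl])

lemma measurable_mixture_density [measurable]: "f t \<in> borel_measurable P"
  unfolding mixture_density_def by measurable

lemma measurable_mixture_density' [measurable]: "f t \<in> borel_measurable \<mu>"
  unfolding mixture_density_def using q(1) by measurable

lemma measurable_ratio [measurable]: "(\<lambda>\<xi>. density_ratio \<xi> $ j) \<in> borel_measurable P"
  by (simp add: density_ratio_def)

lemma model_eq_density:
  "t \<in> prob_simplex \<Longrightarrow> mixture \<Xi> Q t = density \<mu> (\<lambda>\<xi>. ennreal (f t \<xi>))"
  by (rule mixture_eq_density[OF \<mu> q])

lemmas true_eq_density = model_eq_density[OF c(1)]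

lemma AE_density_pos: "AE \<xi> in P. \<xi> \<in> \<Xi> \<and> 0 < f c \<xi>"
  unfolding true_eq_density
  by (subst AE_density) (auto simp: space_reference intro!: AE_I2)

lemma density_ratio_mem_range:
  assumes "\<xi> \<in> \<Xi>" "0 < f c \<xi>"
  shows "density_ratio \<xi> \<in> ratio_range"
  using assms q(2) inner_ratio[of c \<xi>] by (auto simp: ratio_range_def density_ratio_def)

lemma AE_ratio: "AE \<xi> in P. density_ratio \<xi> \<in> ratio_range"
  using AE_density_pos by eventually_elim (auto intro: density_ratio_mem_range)

lemma compact_core_simplex: "compact core_simplex"
proof -
  have "core_simplex = prob_simplex \<inter> (\<Inter>j. {t. c $ j / 2 \<le> t $ j})"
    by (auto simp: core_simplex_def)
  also have "compact \<dots>"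
    by (intro compact_Int_closed compact_prob_simplex closed_INT ballI closed_Collect_le continuous_intros)
  finally show ?thesis .
qed

lemma true_mem_core_simplex: "c \<in> core_simplex"
  using c less_imp_le[OF c(2)] by (auto simp: core_simplex_def field_simps)

text \<open>Boundedness rests on positivity of \<open>c\<close>: each term
  \<open>c $ j * x $ j\<close> is at most \<open>c \<bullet> x = 1\<close>, whence
  \<open>x $ j \<le> 1 / c $ j\<close>.\<close>

lemma compact_ratios: "compact ratio_range"
proof -
  have "ratio_range = (\<Inter>j. {x. 0 \<le> x $ j}) \<inter> {x. c \<bullet> x = 1}" by (auto simp: ratio_range_def)
  also have "closed \<dots>"
    by (intro closed_Int closed_INT ballI closed_Collect_le closed_Collect_eq continuous_intros)
  finally have "closed ratio_range" .
  moreover have "bounded ratio_range"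
  proof (rule boundedI)
    fix x assume x: "x \<in> ratio_range"
    have "\<bar>x $ j\<bar> \<le> 1 / c $ j" for j
    proof -
      have "c $ j * x $ j \<le> (\<Sum>j\<in>UNIV. c $ j * x $ j)"
        using x
        by (intro member_le_sum) (auto simp: ratio_range_def intro!: mult_nonneg_nonneg less_imp_le[OF c(2)])
      also have "\<dots> = 1" using x by (simp add: ratio_range_def inner_vec_def)
      finally show ?thesis using x c(2)[of j] by (simp add: ratio_range_def field_simps)
    qed
    then show "norm x \<le> (\<Sum>j\<in>UNIV. 1 / c $ j)"
      by (intro order_trans[OF norm_le_l1_cart] sum_mono)
  qed
  ultimately show ?thesis by (simp add: compact_eq_bounded_closed)
qed

text \<open>Since \<open>t\<close> dominates \<open>c / 2\<close> entrywise,
  \<open>t \<bullet> x\<close> is at least half of \<open>c \<bullet> x\<close>. This lower bound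
  makes the logarithm and the inverse square continuous on the compact product.\<close>

lemma inner_core_simplex_ratios:
  assumes "t \<in> core_simplex" "x \<in> ratio_range"
  shows "1 / 2 \<le> t \<bullet> x"
proof -
  have "1 / 2 = (\<Sum>j\<in>UNIV. c $ j / 2 * x $ j)"
    using assms(2) by (simp add: ratio_range_def inner_vec_def flip: sum_divide_distrib)
  also have "\<dots> \<le> (\<Sum>j\<in>UNIV. t $ j * x $ j)"
    using assms by (intro sum_mono mult_right_mono) (auto simp: core_simplex_def ratio_range_def)
  finally show ?thesis by (simp add: inner_vec_def)
qed

lemma continuous_on_ln_inner: "continuous_on (core_simplex \<times> ratio_range) (\<lambda>(t, x). ln (t \<bullet> x))"
  using inner_core_simplex_ratios
  by (force intro!: continuous_intros simp: case_prod_unfold)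

lemma continuous_on_information:
  "continuous_on (core_simplex \<times> ratio_range) (\<lambda>(t, x). x $ k * x $ l / (t \<bullet> x)\<^sup>2)"
  using inner_core_simplex_ratios
  by (force intro!: continuous_intros simp: case_prod_unfold)

section \<open>Likelihood ratios and the Kullback--Leibler divergence\<close>

lemma measurable_inner_ratio [measurable]: "(\<lambda>\<xi>. t \<bullet> density_ratio \<xi>) \<in> borel_measurable P"
  by (simp add: inner_ratio)

text \<open>Change of measure to \<open>\<mu>\<close>, where the true density cancels. Where it is
  0, the density at \<open>t\<close> is 0 too, so no mass is lost.\<close>

lemma integral_likelihood_ratio:
  assumes "t \<in> prob_simplex"
  shows "(\<integral>\<xi>. t \<bullet> density_ratio \<xi> \<partial>P) = 1"
proof -
  have "(\<integral>\<xi>. t \<bullet> density_ratio \<xi> \<partial>P) = (\<integral>\<xi>. f c \<xi> *\<^sub>R (t \<bullet> density_ratio \<xi>) \<partial>\<mu>)"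
    unfolding true_eq_density
    by (rule integral_density)
      (use mixture_density_nonneg[OF c(1)] in \<open>auto simp: inner_ratio space_reference\<close>)
  also have "\<dots> = (\<integral>\<xi>. f t \<xi> \<partial>\<mu>)"
  proof (rule Bochner_Integration.integral_cong[OF refl])
    fix \<xi> assume "\<xi> \<in> space \<mu>"
    then show "f c \<xi> *\<^sub>R (t \<bullet> density_ratio \<xi>) = f t \<xi>"
      using components_zero[of \<xi>] by (auto simp: inner_ratio space_reference mixture_density_def)
  qed
  also have "\<dots> = (\<integral>\<xi>. f t \<xi> *\<^sub>R 1 \<partial>\<mu>)" by simp
  also have "\<dots> = (\<integral>\<xi>. 1 \<partial>mixture \<Xi> Q t)"
    unfolding model_eq_density[OF assms]
    by (rule integral_density[symmetric])
      (use mixture_density_nonneg[OF assms] in \<open>auto simp: space_reference\<close>)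
  also have "\<dots> = 1"
    using prob_space.prob_space[OF prob_space_mixture[OF Q(2,1) assms]] by simp
  finally show ?thesis .
qed

text \<open>Strict Gibbs inequality: \<open>ln y \<le> y - 1\<close> with equality only at 1, and
  the likelihood ratio has mean 1. A nonnegative mean logarithm would make the ratio 1 almost
  everywhere, so both distributions would agree, against identifiability.\<close>

lemma expected_log_ratio_neg:
  assumes identifiable: "inj_on (mixture \<Xi> Q) prob_simplex"
    and t: "t \<in> core_simplex" "t \<noteq> c"
  shows "(\<integral>\<xi>. ln (t \<bullet> density_ratio \<xi>) \<partial>P) < 0"
proof (rule ccontr)
  assume neg: "\<not> ?thesis"
  have t': "t \<in> prob_simplex" using t by (simp add: core_simplex_def)
  interpret prob_space P by (rule prob_space_true)
  have int_ln: "integrable P (\<lambda>\<xi>. ln (t \<bullet> density_ratio \<xi>))"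
    by (rule integrable_parametric[OF prob_space_true compact_core_simplex compact_ratios
          continuous_on_ln_inner AE_ratio _ t(1)]) measurable
  have int: "integrable P (\<lambda>\<xi>. t \<bullet> density_ratio \<xi>)"
    by (rule integrable_parametric[where \<psi> = "\<lambda>t x. t \<bullet> x", OF prob_space_true compact_core_simplex
          compact_ratios _ AE_ratio _ t(1)]) (auto intro!: continuous_intros simp: case_prod_unfold)
  have pos: "AE \<xi> in P. 0 < t \<bullet> density_ratio \<xi>"
    using AE_ratio by eventually_elim (use inner_core_simplex_ratios[OF t(1)] in force)
  let ?h = "\<lambda>\<xi>. t \<bullet> density_ratio \<xi> - 1 - ln (t \<bullet> density_ratio \<xi>)"
  have nonneg: "AE \<xi> in P. 0 \<le> ?h \<xi>"
    using pos by eventually_elim (simp add: ln_le_minus_one)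
  have int_h: "integrable P ?h" using int int_ln by simp
  have "(\<integral>\<xi>. ?h \<xi> \<partial>P) = - (\<integral>\<xi>. ln (t \<bullet> density_ratio \<xi>) \<partial>P)"
    using int int_ln integral_likelihood_ratio[OF t'] by (simp add: prob_space)
  with neg integral_nonneg_AE[OF nonneg] have "(\<integral>\<xi>. ?h \<xi> \<partial>P) = 0" by linarith
  then have "AE \<xi> in P. ?h \<xi> = 0"
    using integral_nonneg_eq_0_iff_AE[OF int_h nonneg] by simp
  with pos have "AE \<xi> in P. f t \<xi> / f c \<xi> = 1"
    by eventually_elim (metis inner_ratio ln_eq_minus_one right_minus_eq)
  then have "AE \<xi> in \<mu>. 0 < f c \<xi> \<longrightarrow> f t \<xi> / f c \<xi> = 1"
    unfolding true_eq_density by (subst (asm) AE_density) auto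
  \<comment> \<open>To pass to \<open>\<mu>\<close>, the set where the true density is 0 has to be
    covered too; both densities vanish there.\<close>
  then have "AE \<xi> in \<mu>. ennreal (f t \<xi>) = ennreal (f c \<xi>)"
    using AE_space
  proof eventually_elim
    case (elim \<xi>)
    then have \<xi>: "\<xi> \<in> \<Xi>" by (simp add: space_reference)
    show ?case
    proof (cases "f c \<xi> = 0")
      case True
      then show ?thesis using components_zero[OF \<xi>] by (simp add: mixture_density_def)
    next
      case False
      with mixture_density_nonneg[OF c(1) \<xi>] elim show ?thesis by simp
    qed
  qed
  then have "mixture \<Xi> Q t = P"
    unfolding model_eq_density[OF c(1)] model_eq_density[OF t']
    by (intro density_cong) auto
  with identifiable t' c(1) t(2) show False by (auto dest: inj_onD)
qed

text \<open>The estimate may lie on the boundary of the simplex, where the log-ratio is unbounded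
  below; its midpoint with \<open>c\<close> stays in the core. Maximality gives a likelihood ratio
  of at least 1, which concavity of the logarithm carries over to the midpoint.\<close>

lemma midpoint_mle:
  assumes mle: "is_mle f N \<omega> t" and \<omega>: "\<And>i. \<omega> i \<in> \<Xi> \<and> 0 < f c (\<omega> i)"
  shows "midpoint t c \<in> core_simplex" "0 \<le> (\<Sum>i<N. ln (midpoint t c \<bullet> density_ratio (\<omega> i))) / real N"
proof -
  have t: "t \<in> prob_simplex" and max: "likelihood f N \<omega> c \<le> likelihood f N \<omega> t"
    using mle c(1) by (auto simp: is_mle_def is_arg_max_def not_less)
  have "midpoint t c = (1 / 2) *\<^sub>R t + (1 / 2) *\<^sub>R c"
    by (simp add: midpoint_def scaleR_add_right)
  also have "\<dots> \<in> prob_simplex"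
    by (rule convexD[OF convex_prob_simplex t c(1)]) auto
  finally show mem: "midpoint t c \<in> core_simplex"
    using t by (auto simp: core_simplex_def midpoint_def prob_simplex_def)
  let ?y = "\<lambda>i. t \<bullet> density_ratio (\<omega> i)" and ?w = "\<lambda>i. midpoint t c \<bullet> density_ratio (\<omega> i)"
  have w: "?w i = (?y i + 1) / 2" for i
    using \<omega>[of i] inner_ratio[of c "\<omega> i"]
    by (simp add: midpoint_def inner_add_left)
  have y: "0 \<le> ?y i" for i
    using \<omega>[of i] mixture_density_nonneg[OF t, of "\<omega> i"] by (simp add: inner_ratio)
  have "0 < likelihood f N \<omega> c"
    unfolding likelihood_def using \<omega> by (intro prod_pos) auto
  with max have "1 \<le> likelihood f N \<omega> t / likelihood f N \<omega> c" by simp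
  also have "\<dots> = (\<Prod>i<N. ?y i)"
    by (simp add: likelihood_def inner_ratio prod_dividef)
  also have "\<dots> \<le> (\<Prod>i<N. (?w i)\<^sup>2)"
  proof (intro prod_mono conjI y)
    fix i
    \<comment> \<open>The inequality of arithmetic and geometric means for \<open>?y i\<close> and
      1, in squared form.\<close>
    have "0 \<le> (?y i - 1)\<^sup>2" by simp
    then show "?y i \<le> (?w i)\<^sup>2" unfolding w by (simp add: power2_eq_square field_simps)
  qed
  finally have "0 \<le> ln (\<Prod>i<N. (?w i)\<^sup>2)" by simp
  also have "\<dots> = (\<Sum>i<N. ln ((?w i)\<^sup>2))"
    using y by (intro ln_prod) (auto simp: w add_nonneg_eq_0_iff)
  also have "\<dots> = 2 * (\<Sum>i<N. ln (?w i))"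
    using y by (simp add: w ln_realpow sum_distrib_left add_nonneg_pos)
  finally show "0 \<le> (\<Sum>i<N. ln (?w i)) / real N" by simp
qed

text \<open>The Hessian formula applies because the ratio is at least 1/2 on the core. Dividing
  numerator and denominator by the squared true density turns the result into an empirical mean of a
  bounded function.\<close>

lemma observed_information_eq:
  assumes t: "t \<in> core_simplex" and \<omega>: "\<And>i. \<omega> i \<in> \<Xi> \<and> 0 < f c (\<omega> i)"
  shows "observed_information f N \<omega> t $ k $ l =
    (\<Sum>i<N. density_ratio (\<omega> i) $ k * density_ratio (\<omega> i) $ l / (t \<bullet> density_ratio (\<omega> i))\<^sup>2) / real N"
proof -
  have "0 < t \<bullet> (\<chi> j. q j (\<omega> i))" for i
  proof -
    have "0 < f t (\<omega> i) / f c (\<omega> i)"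
      using inner_core_simplex_ratios[OF t density_ratio_mem_range, of "\<omega> i"] \<omega>[of i]
      by (simp add: inner_ratio)
    with \<omega>[of i] show ?thesis by (simp add: zero_less_divide_iff mixture_density_eq_inner)
  qed
  from hessian_ln_prod_inner[of N t "\<lambda>i. \<chi> j. q j (\<omega> i)", OF this]
  have "observed_information f N \<omega> t $ k $ l =
      (\<Sum>i<N. q k (\<omega> i) * q l (\<omega> i) / (f t (\<omega> i))\<^sup>2) / real N"
    by (simp add: observed_information_def likelihood_def flip: mixture_density_eq_inner)
  also have "(\<Sum>i<N. q k (\<omega> i) * q l (\<omega> i) / (f t (\<omega> i))\<^sup>2) =
      (\<Sum>i<N. density_ratio (\<omega> i) $ k * density_ratio (\<omega> i) $ l / (t \<bullet> density_ratio (\<omega> i))\<^sup>2)"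
  proof (rule sum.cong[OF refl])
    fix i
    have "f c (\<omega> i) \<noteq> 0" using \<omega>[of i] by simp
    then show "q k (\<omega> i) * q l (\<omega> i) / (f t (\<omega> i))\<^sup>2 =
        density_ratio (\<omega> i) $ k * density_ratio (\<omega> i) $ l / (t \<bullet> density_ratio (\<omega> i))\<^sup>2"
      unfolding inner_ratio by (simp add: density_ratio_def power2_eq_square)
  qed
  finally show ?thesis .
qed

text \<open>The denominator is 1 almost surely; it is kept so that the right side is the limit
  function of the uniform law for the information, taken at \<open>t = c\<close>.\<close>

lemma fisher_information_eq:
  "fisher_information (mixture \<Xi> Q) f c $ k $ l =
    (\<integral>\<xi>. density_ratio \<xi> $ k * density_ratio \<xi> $ l / (c \<bullet> density_ratio \<xi>)\<^sup>2 \<partial>P)"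
proof -
  let ?g = "\<lambda>k l \<xi>. density_ratio \<xi> $ k * density_ratio \<xi> $ l / (c \<bullet> density_ratio \<xi>)\<^sup>2"
  have entry: "- hessian (\<lambda>t. ln (f t \<xi>)) c $ k $ l = ?g k l \<xi>" if \<xi>: "\<xi> \<in> \<Xi>" for \<xi> k l
  proof (cases "f c \<xi> = 0")
    \<comment> \<open>The log-density is constant in the parameter because \<open>ln 0 = 0\<close>, and \<open>density_ratio \<xi> = 0\<close>
      because \<open>x / 0 = 0\<close>.\<close>
    case True
    then have "q j \<xi> = 0" for j using components_zero[OF \<xi>] by simp
    moreover have "gradient (\<lambda>t::real^'n. 0) = (\<lambda>t. 0)"
      by (simp add: fun_eq_iff gradient_def vec_eq_iff frechet_derivative_const)
    ultimately show ?thesis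
      by (simp add: mixture_density_def density_ratio_def hessian_def jacobian_def
          matrix_def frechet_derivative_const)
  next
    case False
    then have "0 < c \<bullet> (\<chi> j. q j \<xi>)"
      using mixture_density_nonneg[OF c(1) \<xi>] by (simp add: mixture_density_eq_inner)
    \<comment> \<open>A single log-density is the log-likelihood of one observation, a product with
      one factor.\<close>
    with hessian_ln_prod_inner[of 1 c "\<lambda>_. \<chi> j. q j \<xi>" k l] False show ?thesis
      unfolding inner_ratio by (simp add: density_ratio_def power2_eq_square flip: mixture_density_eq_inner)
  qed
  have int: "integrable P (?g k l)" for k l
    by (rule integrable_parametric[OF prob_space_true compact_core_simplex compact_ratios
          continuous_on_information AE_ratio _ true_mem_core_simplex]) measurable
  have "fisher_information (mixture \<Xi> Q) f c =
      (\<integral>\<xi>. (\<Sum>k\<in>UNIV. \<Sum>l\<in>UNIV. ?g k l \<xi> *\<^sub>R axis k (axis l 1)) \<partial>P)"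
    unfolding fisher_information_def
  proof (rule Bochner_Integration.integral_cong[OF refl])
    fix \<xi> assume "\<xi> \<in> space P"
    then have "\<xi> \<in> \<Xi>" by (simp add: space_mixture)
    then show "- hessian (\<lambda>t. ln (f t \<xi>)) c =
        (\<Sum>k\<in>UNIV. \<Sum>l\<in>UNIV. ?g k l \<xi> *\<^sub>R axis k (axis l 1))"
      using entry by (simp only: vec_eq_iff matrix_unit_expansion_nth vector_uminus_component simp_thms)
  qed
  also have "\<dots> = (\<Sum>k\<in>UNIV. \<Sum>l\<in>UNIV. (\<integral>\<xi>. ?g k l \<xi> \<partial>P) *\<^sub>R axis k (axis l 1))"
    using int by simp
  finally show ?thesis
    by (simp only: matrix_unit_expansion_nth)
qed

text \<open>Outside one null set all observations have positive true density and both uniform laws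
  hold; for such a sample the argument is deterministic.\<close>

lemma mle_consistent_and_radius_tendsto_0:
  assumes identifiable: "inj_on (mixture \<Xi> Q) prob_simplex"
    and fisher: "invertible (fisher_information (mixture \<Xi> Q) f c)"
    and mle: "\<And>N \<omega>. 1 \<le> N \<Longrightarrow> \<omega> \<in> space (PiM (UNIV::nat set) (\<lambda>_. P)) \<Longrightarrow> is_mle f N \<omega> (\<theta>hat N \<omega>)"
  shows "AE \<omega> in PiM (UNIV::nat set) (\<lambda>_. P).
    (\<lambda>N. \<theta>hat N \<omega>) \<longlonglongrightarrow> c \<and> (\<lambda>N. mle_radius f \<alpha> N \<omega> (\<theta>hat N \<omega>)) \<longlonglongrightarrow> 0"
proof -
  let ?PN = "PiM (UNIV::nat set) (\<lambda>_. P)"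
  let ?g = "\<lambda>k l t x. x $ k * x $ l / (t \<bullet> x)\<^sup>2"
  have "AE \<omega> in ?PN. \<omega> i \<in> \<Xi> \<and> 0 < f c (\<omega> i)" for i
    by (rule AE_PiM_component[OF prob_space_true UNIV_I AE_density_pos])
  then have good: "AE \<omega> in ?PN. \<forall>i. \<omega> i \<in> \<Xi> \<and> 0 < f c (\<omega> i)"
    by (subst AE_all_countable) simp
  note meas = prob_space_true compact_core_simplex compact_ratios
  have law_ln: "AE \<omega> in ?PN. uniform_limit core_simplex
      (\<lambda>N t. (\<Sum>i<N. ln (t \<bullet> density_ratio (\<omega> i))) / real N) (\<lambda>t. \<integral>\<xi>. ln (t \<bullet> density_ratio \<xi>) \<partial>P) sequentially"
    by (rule uniform_strong_law[OF meas continuous_on_ln_inner AE_ratio]) measurable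
  have "AE \<omega> in ?PN. uniform_limit core_simplex
      (\<lambda>N t. (\<Sum>i<N. ?g k l t (density_ratio (\<omega> i))) / real N) (\<lambda>t. \<integral>\<xi>. ?g k l t (density_ratio \<xi>) \<partial>P) sequentially" for k l
    by (rule uniform_strong_law[OF meas continuous_on_information AE_ratio]) measurable
  then have law_info: "AE \<omega> in ?PN. \<forall>k l. uniform_limit core_simplex
      (\<lambda>N t. (\<Sum>i<N. ?g k l t (density_ratio (\<omega> i))) / real N) (\<lambda>t. \<integral>\<xi>. ?g k l t (density_ratio \<xi>) \<partial>P) sequentially"
    by (simp add: AE_all_countable)
  from good law_ln law_info AE_space show ?thesis
  proof eventually_elim
    case (elim \<omega>)
    note good = elim(1)[rule_format] and law_ln = elim(2) and law_info = elim(3)[rule_format]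
    have mle\<omega>: "is_mle f N \<omega> (\<theta>hat N \<omega>)" if "1 \<le> N" for N
      using mle[OF that] elim(4) by simp
    have "(\<lambda>N. midpoint (\<theta>hat N \<omega>) c) \<longlonglongrightarrow> c"
    proof (rule approximate_maximizer_tendsto[OF compact_core_simplex law_ln])
      show "continuous_on core_simplex (\<lambda>t. \<integral>\<xi>. ln (t \<bullet> density_ratio \<xi>) \<partial>P)"
        by (rule continuous_on_integral_parametric[OF meas continuous_on_ln_inner AE_ratio]) measurable
      show "\<forall>\<^sub>F N in sequentially. midpoint (\<theta>hat N \<omega>) c \<in> core_simplex \<and>
          0 \<le> (\<Sum>i<N. ln (midpoint (\<theta>hat N \<omega>) c \<bullet> density_ratio (\<omega> i))) / real N"
        using eventually_ge_at_top[of 1]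
        by eventually_elim (use midpoint_mle[OF mle\<omega> good] in auto)
    qed (rule expected_log_ratio_neg[OF identifiable])
    \<comment> \<open>Reflecting the midpoint in the sense \<open>2 *\<^sub>R m - c\<close> recovers
      the estimate.\<close>
    then have "(\<lambda>N. 2 *\<^sub>R midpoint (\<theta>hat N \<omega>) c - c) \<longlonglongrightarrow> 2 *\<^sub>R c - c"
      by (intro tendsto_intros)
    then have lim: "(\<lambda>N. \<theta>hat N \<omega>) \<longlonglongrightarrow> c"
      by (simp add: midpoint_def scaleR_2)
    \<comment> \<open>Consistency now places the estimate itself in the core, so the law for the
      information can be used at the estimate and not just at the midpoint.\<close>
    have "\<forall>\<^sub>F N in sequentially. \<forall>j. c $ j / 2 < \<theta>hat N \<omega> $ j"
    proof (rule eventually_all_finite)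
      fix j
      have "(\<lambda>N. \<theta>hat N \<omega> $ j) \<longlonglongrightarrow> c $ j" by (intro tendsto_intros lim)
      then show "\<forall>\<^sub>F N in sequentially. c $ j / 2 < \<theta>hat N \<omega> $ j"
        using c(2)[of j] by (intro order_tendstoD) auto
    qed
    then have mem: "\<forall>\<^sub>F N in sequentially. \<theta>hat N \<omega> \<in> core_simplex"
      using eventually_ge_at_top[of 1]
    proof eventually_elim
      case (elim N)
      with mle\<omega>[of N] show ?case
        by (auto simp: core_simplex_def is_mle_def is_arg_max_def intro: less_imp_le)
    qed
    have "(\<lambda>N. observed_information f N \<omega> (\<theta>hat N \<omega>) $ k $ l) \<longlonglongrightarrow>
        fisher_information (mixture \<Xi> Q) f c $ k $ l" for k l
    proof (rule Lim_transform_eventually)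
      \<comment> \<open>Uniformity over the core permits evaluation at the moving parameter.\<close>
      show "(\<lambda>N. (\<Sum>i<N. ?g k l (\<theta>hat N \<omega>) (density_ratio (\<omega> i))) / real N) \<longlonglongrightarrow>
          fisher_information (mixture \<Xi> Q) f c $ k $ l"
        unfolding fisher_information_eq
        by (rule uniform_limit_compose_tendsto[OF law_info _ mem true_mem_core_simplex lim],
            rule continuous_on_integral_parametric[OF meas continuous_on_information AE_ratio]) measurable
      show "\<forall>\<^sub>F N in sequentially. (\<Sum>i<N. ?g k l (\<theta>hat N \<omega>) (density_ratio (\<omega> i))) / real N =
          observed_information f N \<omega> (\<theta>hat N \<omega>) $ k $ l"
        using mem by eventually_elim (rule observed_information_eq[OF _ good, symmetric])
    qed
    from mle_radius_tendsto_0[OF fisher this] lim show ?case by simp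
  qed
qed

end

section \<open>Combination of consistency with stability of the solution set\<close>

theorem theorem3:
  fixes X :: "(real^'d) set"
    and \<Xi> :: "(real^'m) set"
    and Q :: "'n::finite \<Rightarrow> (real^'m) measure"
    and \<Phi> :: "real^'d \<Rightarrow> real^'m \<Rightarrow> real^'d"
    and \<phi> :: "real^'d \<Rightarrow> real^'m \<Rightarrow> real"
    and L :: "'n \<Rightarrow> real"
    and \<mu> :: "(real^'m) measure"
    and q :: "'n \<Rightarrow> real^'m \<Rightarrow> real"
    and \<nu> :: "(real^'n) measure"
    and p :: "real^'n \<Rightarrow> real"
    and \<theta>c :: "real^'n"
    and rc \<alpha> :: real
    and \<theta>hat :: "nat \<Rightarrow> (nat \<Rightarrow> real^'m) \<Rightarrow> real^'n"
  assumes X: "X \<noteq> {}" "closed X" "convex X" "compact X"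
    and Q: "\<And>j. prob_space (Q j)" "\<And>j. sets (Q j) = sets (restrict_space borel \<Xi>)"
    and \<Phi>: "\<And>\<xi>. \<xi> \<in> \<Xi> \<Longrightarrow> continuous_on X (\<lambda>x. \<Phi> x \<xi>)"
      "\<And>x j. x \<in> X \<Longrightarrow> integrable (Q j) (\<Phi> x)"
    and \<phi>: "\<And>\<xi>. \<xi> \<in> \<Xi> \<Longrightarrow> continuous_on X (\<lambda>x. \<phi> x \<xi>)"
      "\<And>x j. x \<in> X \<Longrightarrow> integrable (Q j) (\<phi> x)"
    \<comment> \<open>densities with respect to a common reference measure, and identifiability\<close>
    and \<mu>: "sigma_finite_measure \<mu>" "sets \<mu> = sets (restrict_space borel \<Xi>)"
    and q: "\<And>j. q j \<in> borel_measurable \<mu>" "\<And>j \<xi>. \<xi> \<in> \<Xi> \<Longrightarrow> 0 \<le> q j \<xi>"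
      "\<And>j. Q j = density \<mu> (\<lambda>\<xi>. ennreal (q j \<xi>))"
    and identifiable: "inj_on (mixture \<Xi> Q) prob_simplex"
    and params: "\<theta>c \<in> prob_simplex" "0 \<le> rc" "0 < \<alpha>" "\<alpha> < 1"
    \<comment> \<open>prior density with respect to a reference measure on the simplex\<close>
    and prior: "sets \<nu> = sets (restrict_space borel prob_simplex)" "p \<in> borel_measurable \<nu>"
      "\<And>\<theta>. \<theta> \<in> prob_simplex \<Longrightarrow> 0 \<le> p \<theta>" "prob_space (density \<nu> (\<lambda>\<theta>. ennreal (p \<theta>)))"
    and mle: "\<And>N \<omega>. 1 \<le> N \<Longrightarrow> \<omega> \<in> space (\<Pi>\<^sub>M i\<in>(UNIV::nat set). mixture \<Xi> Q \<theta>c) \<Longrightarrow>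
      is_mle (mixture_density q) N \<omega> (\<theta>hat N \<omega>)"
    and i: "\<theta>c \<in> rel_interior prob_simplex"
    and ii: "AE \<omega> in (\<Pi>\<^sub>M i\<in>(UNIV::nat set). mixture \<Xi> Q \<theta>c). \<forall>N\<ge>1.
      twice_cont_differentiable_near (\<lambda>\<theta>. ln (likelihood (mixture_density q) N \<omega> \<theta>)) \<theta>c"
    and iii: "invertible (fisher_information (mixture \<Xi> Q) (mixture_density q) \<theta>c)"
    and iv: "\<exists>U. open U \<and> \<theta>c \<in> U \<and> continuous_on (U \<inter> prob_simplex) p \<and>
      (\<forall>\<theta>\<in>U \<inter> prob_simplex. 0 < p \<theta>)"
    and v: "\<forall>\<theta>\<in>prob_simplex. \<exists>g. integrable (mixture \<Xi> Q \<theta>c) g \<and>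
      (AE \<xi> in mixture \<Xi> Q \<theta>c. 0 < mixture_density q \<theta> \<xi> \<and> \<bar>ln (mixture_density q \<theta> \<xi>)\<bar> \<le> g \<xi>)"
      "\<exists>c1 c2. 0 < c1 \<and> c1 < c2 \<and> (\<forall>\<theta>\<in>prob_simplex. c1 \<le> p \<theta> \<and> p \<theta> \<le> c2)"
    and mean_\<Phi>: "\<And>j. continuous_on X (\<lambda>x. \<integral>\<xi>. \<Phi> x \<xi> \<partial>Q j)"
    and mean_\<phi>: "\<And>j. 0 < L j" "\<And>j. (L j)-lipschitz_on X (\<lambda>x. \<integral>\<xi>. \<phi> x \<xi> \<partial>Q j)"
  shows "AE \<omega> in (\<Pi>\<^sub>M i\<in>(UNIV::nat set). mixture \<Xi> Q \<theta>c).
    (\<lambda>N. excess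
       (solution_set X Q \<Phi> \<phi> (\<theta>hat N \<omega>)
          (rc + mle_radius (mixture_density q) \<alpha> N \<omega> (\<theta>hat N \<omega>)))
       (solution_set X Q \<Phi> \<phi> \<theta>c rc)) \<longlonglongrightarrow> 0"
proof -
  have pos: "0 < \<theta>c $ j" for j
    by (rule rel_interior_prob_simplex_pos[OF i])
  have stat: "AE \<omega> in (\<Pi>\<^sub>M i\<in>(UNIV::nat set). mixture \<Xi> Q \<theta>c). (\<lambda>N. \<theta>hat N \<omega>) \<longlonglongrightarrow> \<theta>c \<and>
      (\<lambda>N. mle_radius (mixture_density q) \<alpha> N \<omega> (\<theta>hat N \<omega>)) \<longlonglongrightarrow> 0"
    by (rule mle_consistent_and_radius_tendsto_0[OF Q \<mu>(2) q params(1) pos identifiable iii mle])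
  from stat AE_space show ?thesis
  proof eventually_elim
    case (elim \<omega>)
    show ?case
    \<comment> \<open>For a fixed sample sequence only deterministic stability remains.\<close>
    proof (rule excess_solution_set_tendsto_0[OF X(4) mean_\<Phi>])
      show "continuous_on X (\<lambda>x. \<integral>\<xi>. \<phi> x \<xi> \<partial>Q j)" for j
        by (rule lipschitz_on_continuous_on[OF mean_\<phi>(2)])
      \<comment> \<open>Only eventually, since the estimate is specified from \<open>N = 1\<close>
        on.\<close>
      show "\<forall>\<^sub>F N in sequentially. \<theta>hat N \<omega> \<in> prob_simplex"
        using eventually_ge_at_top[of 1]
        by eventually_elim (use mle[OF _ elim(2)] in \<open>auto simp: is_mle_def is_arg_max_def\<close>)
      show "(\<lambda>N. \<theta>hat N \<omega>) \<longlonglongrightarrow> \<theta>c" using elim(1) by simp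
      have "(\<lambda>N. rc + mle_radius (mixture_density q) \<alpha> N \<omega> (\<theta>hat N \<omega>)) \<longlonglongrightarrow> rc + 0"
        using elim(1) by (intro tendsto_add tendsto_const) simp
      then show "(\<lambda>N. rc + mle_radius (mixture_density q) \<alpha> N \<omega> (\<theta>hat N \<omega>)) \<longlonglongrightarrow> rc" by simp
    qed
  qed
qed

end
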